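(* Hierarchically hyperbolic groups have finitely many conjugacy classes of finite subgroups.
   Context: Hierarchically hyperbolic space (HHS). A quasigeodesic metric space $(X,d)$ is an HHS, written $(X,\mathfrak S)$, if there are a constant $E\ge 1$, a set $\mathfrak S$ (of "domains"), and for each $U\in\mathfrak S$ a geodesic $E$-hyperbolic space $\mathcal CU$, with the following. Write $d_U(x,y)=d_{\mathcal CU}(\pi_U(x),\pi_U(y))$ for $x,y\in X$, and similarly for subsets of $X$ or $\mathcal CU$; distances between sets are infima. (1) Projections: for each $U$ there is an $E$-coarsely onto, $(E,E)$-coarsely Lipschitz map $\pi_U:X\to\mathcal CU$. (2) Nesting: $\mathfrak S$ has a partial order $\sqsubseteq$ with a unique maximal element (if $\mathfrak S\ne\emptyset$). If $U\sqsubsetneq V$ there are a nonempty set $\rho^U_V\subset\mathcal CV$ of diameter at most $E$ and a map $\rho^V_U:\mathcal CV\to\mathcal CU$. (3) Orthogonality: there is a symmetric, anti-reflexive relation $\bot$ on $\mathfrak S$; if $U\sqsubseteq V$ and $V\bot W$ then $U\bot W$; orthogonal domains are not $\sqsubseteq$-comparable; for each $T\in\mathfrak S$ and $U\sqsubseteq T$ such that some $V\sqsubseteq T$ has $V\bot U$, there is $W\sqsubsetneq T$ such that every $V\sqsubseteq T$ with $V\bot U$ satisfies $V\sqsubseteq W$. (4) Transversality and consistency: $U,V$ are transverse, $U\pitchfork V$, if they are neither orthogonal nor $\sqsubseteq$-comparable; then there are nonempty sets $\rho^U_V\subset\mathcal CV$, $\rho^V_U\subset\mathcal CU$ of diameter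 at most $E$ with $\min\{d_U(x,\rho^V_U),d_V(x,\rho^U_V)\}\le E$ for all $x\in X$. If $U\sqsubsetneq V$ then $\min\{d_V(x,\rho^U_V),\operatorname{diam}(\{\pi_U(x)\}\cup\rho^V_U(\pi_V(x)))\}\le E$ for all $x\in X$. If $U\sqsubseteq V$, then $d_W(\rho^U_W,\rho^V_W)\le E$ whenever $V\sqsubsetneq W$, or $V\pitchfork W$ and $W\not\perp U$. (5) Finite complexity: the cardinalities of sets of pairwise $\sqsubseteq$-comparable domains are at most $E$. (6) Large links: for $W\in\mathfrak S$ and $x,x'\in X$, put $N=E\,d_W(x,x')+E$. There are $T_1,\dots,T_{\lfloor N\rfloor}\sqsubsetneq W$ such that every $T\sqsubsetneq W$ satisfies $T\sqsubseteq T_i$ for some $i$ or $d_T(x,x')<E$; and $d_W(x,\rho^{T_i}_W)\le N$ for all $i$. (7) Bounded geodesic image: if $U\sqsubsetneq V$ and $\gamma\subset\mathcal CV$ is a geodesic with $d_V(\gamma,\rho^U_V)>E$, then $\operatorname{diam}\rho^V_U(\gamma)\le E$. (8) Partial realisation: if $\{U_i\}$ is a set of pairwise orthogonal domains and $p_i\in\mathcal CU_i$, there is $x\in X$ with $d_{U_i}(x,p_i)\le E$ for all $i$ and $d_V(x,\rho^{U_i}_V)\le E$ whenever $U_i\sqsubsetneq V$ or $U_i\pitchfork V$. (9) Uniqueness: for each $\kappa\ge0$ there is $\theta(\kappa)$ such that if $d(x,y)\ge\theta(\kappa)$ then $d_V(x,y)\ge\kappa$ for some $V\in\mathfrak S$.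 Hierarchically hyperbolic group (HHG). A finitely generated group $G$ is an HHG if its Cayley graph (with respect to a finite generating set) admits an HHS structure $(G,\mathfrak S)$ such that: $G$ acts on $\mathfrak S$, with finitely many orbits, preserving $\sqsubseteq$ and $\bot$; and for each $g\in G$, $U\in\mathfrak S$ there is an isometry $g:\mathcal CU\to\mathcal C(gU)$, compatibly with composition in $G$, such that $g\pi_U(x)=\pi_{gU}(gx)$ for all $x\in G$, and $g\rho^U_V=\rho^{gU}_{gV}$ whenever $U\sqsubsetneq V$ or $U\pitchfork V$. *)

theory Defs
  imports "HOL-Analysis.Abstract_Metric_Spaces" "HOL-Algebra.Generated_Groups"
    "HOL-Algebra.Group_Action"
begin

section \<open>Coarse geometry of metric spaces\<close>

definition set_dist :: "'a metric \<Rightarrow> 'a set \<Rightarrow> 'a set \<Rightarrow> real" where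
  "set_dist m A B = (INF (a, b) \<in> A \<times> B. mdist m a b)"

text \<open>A diameter bound is expressed pointwise, so that an unbounded set satisfies none.\<close>

definition diam_le :: "'a metric \<Rightarrow> 'a set \<Rightarrow> real \<Rightarrow> bool" where
  "diam_le m A r \<longleftrightarrow> (\<forall>a\<in>A. \<forall>b\<in>A. mdist m a b \<le> r)"

definition geodesic_segment :: "'a metric \<Rightarrow> 'a \<Rightarrow> 'a \<Rightarrow> 'a set \<Rightarrow> bool" where
  "geodesic_segment m x y \<gamma> \<longleftrightarrow>
     (\<exists>(c :: real \<Rightarrow> 'a) L. 0 \<le> L \<and> c \<in> {0..L} \<rightarrow> mspace m \<and>
        (\<forall>s\<in>{0..L}. \<forall>t\<in>{0..L}. mdist m (c s) (c t) = \<bar>s - t\<bar>) \<and>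
        c 0 = x \<and> c L = y \<and> \<gamma> = c ` {0..L})"

definition geodesic_space :: "'a metric \<Rightarrow> bool" where
  "geodesic_space m \<longleftrightarrow> (\<forall>x\<in>mspace m. \<forall>y\<in>mspace m. \<exists>\<gamma>. geodesic_segment m x y \<gamma>)"

text \<open>
  Hyperbolicity of a geodesic space is taken in the sense of Rips: every side of a geodesic
  triangle lies in the closed \<open>\<delta>\<close>-neighbourhood of the union of the other two.
\<close>

definition hyperbolic_space :: "'a metric \<Rightarrow> real \<Rightarrow> bool" where
  "hyperbolic_space m \<delta> \<longleftrightarrow>
     (\<forall>x y z \<alpha> \<beta> \<gamma>.
        geodesic_segment m x y \<alpha> \<and> geodesic_segment m y z \<beta> \<and> geodesic_segment m x z \<gamma> \<longrightarrow>
        (\<forall>p\<in>\<alpha>. \<exists>q\<in>\<beta> \<union> \<gamma>. mdist m p q \<le> \<delta>))"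

text \<open>The paths in a quasigeodesic space need not be continuous.\<close>

definition quasigeodesic_space :: "'a metric \<Rightarrow> bool" where
  "quasigeodesic_space m \<longleftrightarrow>
     (\<exists>k\<ge>1. \<forall>x\<in>mspace m. \<forall>y\<in>mspace m.
        \<exists>(c :: real \<Rightarrow> 'a) L. 0 \<le> L \<and> c \<in> {0..L} \<rightarrow> mspace m \<and> c 0 = x \<and> c L = y \<and>
          (\<forall>s\<in>{0..L}. \<forall>t\<in>{0..L}.
             \<bar>s - t\<bar> / k - k \<le> mdist m (c s) (c t) \<and> mdist m (c s) (c t) \<le> k * \<bar>s - t\<bar> + k))"

definition coarsely_onto :: "real \<Rightarrow> 'a metric \<Rightarrow> 'b metric \<Rightarrow> ('a \<Rightarrow> 'b) \<Rightarrow> bool" where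
  "coarsely_onto k m n f \<longleftrightarrow> (\<forall>p\<in>mspace n. \<exists>x\<in>mspace m. mdist n p (f x) \<le> k)"

definition coarsely_lipschitz ::
    "real \<Rightarrow> real \<Rightarrow> 'a metric \<Rightarrow> 'b metric \<Rightarrow> ('a \<Rightarrow> 'b) \<Rightarrow> bool" where
  "coarsely_lipschitz k l m n f \<longleftrightarrow>
     (\<forall>x\<in>mspace m. \<forall>y\<in>mspace m. mdist n (f x) (f y) \<le> k * mdist m x y + l)"

definition isometry_onto :: "'a metric \<Rightarrow> 'b metric \<Rightarrow> ('a \<Rightarrow> 'b) \<Rightarrow> bool" where
  "isometry_onto m n f \<longleftrightarrow>
     f ` mspace m = mspace n \<and>
     (\<forall>p\<in>mspace m. \<forall>q\<in>mspace m. mdist n (f p) (f q) = mdist m p q)"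


section \<open>Hierarchically hyperbolic spaces\<close>

locale domain_system =
  fixes \<SS> :: "'u set"
    and nest :: "'u \<Rightarrow> 'u \<Rightarrow> bool" (infix \<open>\<preceq>\<close> 50)
    and orth :: "'u \<Rightarrow> 'u \<Rightarrow> bool" (infix \<open>\<bottom>\<close> 50)
begin

definition pnest :: "'u \<Rightarrow> 'u \<Rightarrow> bool" (infix \<open>\<prec>\<close> 50) where
  "U \<prec> V \<longleftrightarrow> U \<preceq> V \<and> U \<noteq> V"

definition comparable :: "'u \<Rightarrow> 'u \<Rightarrow> bool" where
  "comparable U V \<longleftrightarrow> U \<preceq> V \<or> V \<preceq> U"

definition transverse :: "'u \<Rightarrow> 'u \<Rightarrow> bool" where
  "transverse U V \<longleftrightarrow> \<not> U \<bottom> V \<and> \<not> comparable U V"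

end

text \<open>
  The parameter \<open>\<rho>\<close> carries the sets: \<open>\<rho> U V\<close> is the subset \<open>\<rho>\<^sup>U\<^sub>V\<close> of \<open>\<C> V\<close>, relevant when
  \<open>U \<prec> V\<close> or \<open>U\<close> and \<open>V\<close> are transverse. The parameter \<open>\<rho>map\<close> carries the downward maps:
  \<open>\<rho>map V U\<close> is the map \<open>\<rho>\<^sup>V\<^sub>U\<close> from \<open>\<C> V\<close> to \<open>\<C> U\<close>, relevant when \<open>U \<prec> V\<close>.
\<close>

locale HHS = domain_system \<SS> nest orth
  for X :: "'x metric"
    and \<SS> :: "'u set"
    and nest :: "'u \<Rightarrow> 'u \<Rightarrow> bool" (infix \<open>\<preceq>\<close> 50)
    and orth :: "'u \<Rightarrow> 'u \<Rightarrow> bool" (infix \<open>\<bottom>\<close> 50)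
    and \<C> :: "'u \<Rightarrow> 'c metric"
    and \<pi> :: "'u \<Rightarrow> 'x \<Rightarrow> 'c"
    and \<rho> :: "'u \<Rightarrow> 'u \<Rightarrow> 'c set"
    and \<rho>map :: "'u \<Rightarrow> 'u \<Rightarrow> 'c \<Rightarrow> 'c"
    and E :: real +
  assumes quasigeodesic: "quasigeodesic_space X"
    and E_ge_1: "E \<ge> 1"
    and geodesic: "\<And>U. U \<in> \<SS> \<Longrightarrow> geodesic_space (\<C> U)"
    and hyperbolic: "\<And>U. U \<in> \<SS> \<Longrightarrow> hyperbolic_space (\<C> U) E"
    \<comment> \<open>projections\<close>
    and proj_maps: "\<And>U. U \<in> \<SS> \<Longrightarrow> \<pi> U \<in> mspace X \<rightarrow> mspace (\<C> U)"
    and proj_coarsely_onto: "\<And>U. U \<in> \<SS> \<Longrightarrow> coarsely_onto E X (\<C> U) (\<pi> U)"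
    and proj_coarsely_lipschitz: "\<And>U. U \<in> \<SS> \<Longrightarrow> coarsely_lipschitz E E X (\<C> U) (\<pi> U)"
    \<comment> \<open>nesting\<close>
    and nest_refl: "reflp_on \<SS> (\<preceq>)"
    and nest_antisym: "antisymp_on \<SS> (\<preceq>)"
    and nest_trans: "transp_on \<SS> (\<preceq>)"
    and unique_maximal: "\<SS> \<noteq> {} \<Longrightarrow> \<exists>!M. M \<in> \<SS> \<and> (\<forall>V\<in>\<SS>. \<not> M \<prec> V)"
    and rho_nest: "\<And>U V. \<lbrakk>U \<in> \<SS>; V \<in> \<SS>; U \<prec> V\<rbrakk> \<Longrightarrow>
          \<rho> U V \<noteq> {} \<and> \<rho> U V \<subseteq> mspace (\<C> V) \<and> diam_le (\<C> V) (\<rho> U V) E"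
    and rho_map: "\<And>U V. \<lbrakk>U \<in> \<SS>; V \<in> \<SS>; U \<prec> V\<rbrakk> \<Longrightarrow> \<rho>map V U \<in> mspace (\<C> V) \<rightarrow> mspace (\<C> U)"
    \<comment> \<open>orthogonality\<close>
    and orth_sym: "symp_on \<SS> (\<bottom>)"
    and orth_irrefl: "irreflp_on \<SS> (\<bottom>)"
    and orth_nest: "\<And>U V W. \<lbrakk>U \<in> \<SS>; V \<in> \<SS>; W \<in> \<SS>; U \<preceq> V; V \<bottom> W\<rbrakk> \<Longrightarrow> U \<bottom> W"
    and orth_not_comparable: "\<And>U V. \<lbrakk>U \<in> \<SS>; V \<in> \<SS>; U \<bottom> V\<rbrakk> \<Longrightarrow> \<not> comparable U V"
    and orth_container: "\<And>T U. \<lbrakk>T \<in> \<SS>; U \<in> \<SS>; U \<preceq> T; \<exists>V\<in>\<SS>. V \<preceq> T \<and> V \<bottom> U\<rbrakk> \<Longrightarrow>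
          \<exists>W\<in>\<SS>. W \<prec> T \<and> (\<forall>V\<in>\<SS>. V \<preceq> T \<and> V \<bottom> U \<longrightarrow> V \<preceq> W)"
    \<comment> \<open>transversality and consistency\<close>
    and rho_transverse: "\<And>U V. \<lbrakk>U \<in> \<SS>; V \<in> \<SS>; transverse U V\<rbrakk> \<Longrightarrow>
          \<rho> U V \<noteq> {} \<and> \<rho> U V \<subseteq> mspace (\<C> V) \<and> diam_le (\<C> V) (\<rho> U V) E"
    and consistency_transverse:
      "\<And>U V x. \<lbrakk>U \<in> \<SS>; V \<in> \<SS>; transverse U V; x \<in> mspace X\<rbrakk> \<Longrightarrow>
          min (set_dist (\<C> U) {\<pi> U x} (\<rho> V U)) (set_dist (\<C> V) {\<pi> V x} (\<rho> U V)) \<le> E"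
    and consistency_nest:
      "\<And>U V x. \<lbrakk>U \<in> \<SS>; V \<in> \<SS>; U \<prec> V; x \<in> mspace X\<rbrakk> \<Longrightarrow>
          set_dist (\<C> V) {\<pi> V x} (\<rho> U V) \<le> E \<or>
          diam_le (\<C> U) ({\<pi> U x} \<union> {\<rho>map V U (\<pi> V x)}) E"
    and consistency_rho:
      "\<And>U V W. \<lbrakk>U \<in> \<SS>; V \<in> \<SS>; W \<in> \<SS>; U \<preceq> V; V \<prec> W \<or> transverse V W \<and> \<not> W \<bottom> U\<rbrakk> \<Longrightarrow>
          set_dist (\<C> W) (\<rho> U W) (\<rho> V W) \<le> E"
    \<comment> \<open>finite complexity\<close>
    and finite_complexity:
      "\<And>\<T>. \<lbrakk>\<T> \<subseteq> \<SS>; pairwise comparable \<T>\<rbrakk> \<Longrightarrow> finite \<T> \<and> real (card \<T>) \<le> E"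
    \<comment> \<open>large links; \<open>\<T>\<close> has at most \<open>\<lfloor>N\<rfloor>\<close> elements and is empty when \<open>W\<close> is minimal\<close>
    and large_links:
      "\<And>W x x' N. \<lbrakk>W \<in> \<SS>; x \<in> mspace X; x' \<in> mspace X;
                  N = E * mdist (\<C> W) (\<pi> W x) (\<pi> W x') + E\<rbrakk> \<Longrightarrow>
          \<exists>\<T>. \<T> \<subseteq> {T \<in> \<SS>. T \<prec> W} \<and> finite \<T> \<and> int (card \<T>) \<le> \<lfloor>N\<rfloor> \<and>
            (\<forall>T\<in>\<SS>. T \<prec> W \<longrightarrow>
               (\<exists>T'\<in>\<T>. T \<preceq> T') \<or> mdist (\<C> T) (\<pi> T x) (\<pi> T x') < E) \<and>
            (\<forall>T\<in>\<T>. set_dist (\<C> W) {\<pi> W x} (\<rho> T W) \<le> N)"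
    \<comment> \<open>bounded geodesic image\<close>
    and bounded_geodesic_image:
      "\<And>U V p q \<gamma>. \<lbrakk>U \<in> \<SS>; V \<in> \<SS>; U \<prec> V; geodesic_segment (\<C> V) p q \<gamma>;
                  set_dist (\<C> V) \<gamma> (\<rho> U V) > E\<rbrakk> \<Longrightarrow>
          diam_le (\<C> U) (\<rho>map V U ` \<gamma>) E"
    \<comment> \<open>partial realisation\<close>
    and partial_realisation:
      "\<And>\<U> p. \<lbrakk>\<U> \<subseteq> \<SS>; pairwise (\<bottom>) \<U>; \<And>U. U \<in> \<U> \<Longrightarrow> p U \<in> mspace (\<C> U)\<rbrakk> \<Longrightarrow>
          \<exists>x\<in>mspace X. \<forall>U\<in>\<U>. mdist (\<C> U) (\<pi> U x) (p U) \<le> E \<and>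
            (\<forall>V\<in>\<SS>. U \<prec> V \<or> transverse U V \<longrightarrow> set_dist (\<C> V) {\<pi> V x} (\<rho> U V) \<le> E)"
    \<comment> \<open>uniqueness\<close>
    and uniqueness:
      "\<And>\<kappa>. \<kappa> \<ge> 0 \<Longrightarrow>
          \<exists>\<theta>. \<forall>x\<in>mspace X. \<forall>y\<in>mspace X. mdist X x y \<ge> \<theta> \<longrightarrow>
            (\<exists>V\<in>\<SS>. mdist (\<C> V) (\<pi> V x) (\<pi> V y) \<ge> \<kappa>)"


section \<open>Cayley graphs\<close>

text \<open>Right multiplication by generators, so that \<open>G\<close> acts on the graph by left multiplication.\<close>

definition cayley_edges :: "('g, 'm) monoid_scheme \<Rightarrow> 'g set \<Rightarrow> ('g \<times> 'g) set" where
  "cayley_edges G A =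
     {(g, h). g \<in> carrier G \<and> h \<in> carrier G \<and>
        (\<exists>a\<in>A. h = g \<otimes>\<^bsub>G\<^esub> a \<or> g = h \<otimes>\<^bsub>G\<^esub> a)}"

definition cayley_dist :: "('g, 'm) monoid_scheme \<Rightarrow> 'g set \<Rightarrow> 'g \<Rightarrow> 'g \<Rightarrow> real" where
  "cayley_dist G A g h = real (LEAST n. (g, h) \<in> cayley_edges G A ^^ n)"

text \<open>The space is the vertex set \<open>carrier G\<close>, without the interiors of edges, with the graph metric.\<close>

definition cayley_metric :: "('g, 'm) monoid_scheme \<Rightarrow> 'g set \<Rightarrow> 'g metric" where
  "cayley_metric G A = metric (carrier G, cayley_dist G A)"

lemma sym_cayley_edges: "sym (cayley_edges G A)"
  by (auto simp: sym_def cayley_edges_def)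

lemma sym_relpow: "sym R \<Longrightarrow> (x, y) \<in> R ^^ n \<Longrightarrow> (y, x) \<in> R ^^ n"
proof (induction n arbitrary: y)
  case (Suc n)
  then show ?case by (metis relpow_Suc_D2' relpow_Suc_E relpow_Suc_I2 symE)
qed auto

lemma cayley_dist_commute: "cayley_dist G A g h = cayley_dist G A h g"
proof -
  have "(g, h) \<in> cayley_edges G A ^^ n \<longleftrightarrow> (h, g) \<in> cayley_edges G A ^^ n" for n
    by (metis sym_relpow sym_cayley_edges)
  then show ?thesis by (simp add: cayley_dist_def)
qed

lemma (in group) cayley_connected_one:
  assumes "A \<subseteq> carrier G" "h \<in> generate G A" "g \<in> carrier G"
  shows "(g, g \<otimes> h) \<in> (cayley_edges G A)\<^sup>*"
  using assms(2,3)
proof (induction arbitrary: g rule: generate.induct)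
  case one
  then show ?case by simp
next
  case (incl h)
  then have "(g, g \<otimes> h) \<in> cayley_edges G A"
    using assms(1) by (auto simp: cayley_edges_def)
  then show ?case by blast
next
  case (inv h)
  then have "h \<in> carrier G" using assms(1) by blast
  then have "(g, g \<otimes> inv h) \<in> cayley_edges G A"
    using inv by (auto simp: cayley_edges_def m_assoc intro!: bexI[of _ h])
  then show ?case by blast
next
  case (eng h1 h2)
  have "h1 \<in> carrier G" "h2 \<in> carrier G"
    using eng assms(1) generate_incl by blast+
  then have "(g, g \<otimes> h1) \<in> (cayley_edges G A)\<^sup>*"
    "(g \<otimes> h1, (g \<otimes> h1) \<otimes> h2) \<in> (cayley_edges G A)\<^sup>*" "(g \<otimes> h1) \<otimes> h2 = g \<otimes> (h1 \<otimes> h2)"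
    using eng.IH(1)[of g] eng.IH(2)[of "g \<otimes> h1"] eng.prems by (simp_all add: m_assoc)
  then show ?case by (metis rtrancl_trans)
qed

lemma (in group) cayley_connected:
  assumes "A \<subseteq> carrier G" "generate G A = carrier G" "g \<in> carrier G" "h \<in> carrier G"
  shows "(g, h) \<in> cayley_edges G A ^^ (LEAST n. (g, h) \<in> cayley_edges G A ^^ n)"
proof -
  have "(g, g \<otimes> (inv g \<otimes> h)) \<in> (cayley_edges G A)\<^sup>*"
    using assms by (intro cayley_connected_one) auto
  then have "(g, h) \<in> (cayley_edges G A)\<^sup>*"
    using assms by (simp add: m_assoc[symmetric])
  then show ?thesis
    by (metis LeastI_ex rtrancl_imp_relpow)
qed

lemma (in group) Metric_space_cayley_dist:
  assumes "A \<subseteq> carrier G" "generate G A = carrier G"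
  shows "Metric_space (carrier G) (cayley_dist G A)"
proof
  show "0 \<le> cayley_dist G A x y" for x y
    by (simp add: cayley_dist_def)
  show "cayley_dist G A x y = cayley_dist G A y x" for x y
    by (rule cayley_dist_commute)
next
  fix x y assume xy: "x \<in> carrier G" "y \<in> carrier G"
  show "cayley_dist G A x y = 0 \<longleftrightarrow> x = y"
    using cayley_connected[OF assms xy]
    by (auto simp: cayley_dist_def simp del: Least_eq_0 intro: Least_eq_0)
next
  fix x y z assume xyz: "x \<in> carrier G" "y \<in> carrier G" "z \<in> carrier G"
  let ?m = "LEAST n. (x, y) \<in> cayley_edges G A ^^ n"
  let ?n = "LEAST n. (y, z) \<in> cayley_edges G A ^^ n"
  have "(x, z) \<in> cayley_edges G A ^^ (?m + ?n)"
    using cayley_connected[OF assms xyz(1,2)] cayley_connected[OF assms xyz(2,3)]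
    by (auto simp: relpow_add)
  then have "(LEAST n. (x, z) \<in> cayley_edges G A ^^ n) \<le> ?m + ?n"
    by (rule Least_le)
  then show "cayley_dist G A x z \<le> cayley_dist G A x y + cayley_dist G A y z"
    unfolding cayley_dist_def by (metis of_nat_add of_nat_mono)
qed

lemma (in group)
  assumes "A \<subseteq> carrier G" "generate G A = carrier G"
  shows mspace_cayley_metric: "mspace (cayley_metric G A) = carrier G"
    and mdist_cayley_metric: "mdist (cayley_metric G A) = cayley_dist G A"
  using Metric_space.mspace_metric[OF Metric_space_cayley_dist[OF assms]]
    Metric_space.mdist_metric[OF Metric_space_cayley_dist[OF assms]]
  by (simp_all add: cayley_metric_def)


section \<open>Hierarchically hyperbolic groups\<close>

text \<open>
  \<open>A\<close> is a finite generating set, \<open>act g U\<close> is the domain \<open>gU\<close>, and \<open>iso g U\<close> is the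
  isometry from \<open>\<C> U\<close> to \<open>\<C> (gU)\<close> induced by \<open>g\<close>.
\<close>

locale HHG = group G + group_action G \<SS> act +
  HHS "cayley_metric G A" \<SS> nest orth \<C> \<pi> \<rho> \<rho>map E
  for G :: "('g, 'm) monoid_scheme" (structure)
    and A :: "'g set"
    and \<SS> :: "'u set"
    and nest :: "'u \<Rightarrow> 'u \<Rightarrow> bool" (infix \<open>\<preceq>\<close> 50)
    and orth :: "'u \<Rightarrow> 'u \<Rightarrow> bool" (infix \<open>\<bottom>\<close> 50)
    and \<C> :: "'u \<Rightarrow> 'c metric"
    and \<pi> :: "'u \<Rightarrow> 'g \<Rightarrow> 'c"
    and \<rho> :: "'u \<Rightarrow> 'u \<Rightarrow> 'c set"
    and \<rho>map :: "'u \<Rightarrow> 'u \<Rightarrow> 'c \<Rightarrow> 'c"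
    and E :: real
    and act :: "'g \<Rightarrow> 'u \<Rightarrow> 'u"
    and iso :: "'g \<Rightarrow> 'u \<Rightarrow> 'c \<Rightarrow> 'c" +
  assumes finite_generators: "finite A"
    and generators_subset: "A \<subseteq> carrier G"
    and generates: "generate G A = carrier G"
    and finite_orbits: "finite (orbits G \<SS> act)"
    and act_nest: "\<And>g U V. \<lbrakk>g \<in> carrier G; U \<in> \<SS>; V \<in> \<SS>\<rbrakk> \<Longrightarrow> act g U \<preceq> act g V \<longleftrightarrow> U \<preceq> V"
    and act_orth: "\<And>g U V. \<lbrakk>g \<in> carrier G; U \<in> \<SS>; V \<in> \<SS>\<rbrakk> \<Longrightarrow> act g U \<bottom> act g V \<longleftrightarrow> U \<bottom> V"
    and isometry: "\<And>g U. \<lbrakk>g \<in> carrier G; U \<in> \<SS>\<rbrakk> \<Longrightarrow> isometry_onto (\<C> U) (\<C> (act g U)) (iso g U)"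
    and iso_mult: "\<And>g h U p. \<lbrakk>g \<in> carrier G; h \<in> carrier G; U \<in> \<SS>; p \<in> mspace (\<C> U)\<rbrakk> \<Longrightarrow>
          iso (g \<otimes> h) U p = iso g (act h U) (iso h U p)"
    and iso_proj: "\<And>g U x. \<lbrakk>g \<in> carrier G; U \<in> \<SS>; x \<in> carrier G\<rbrakk> \<Longrightarrow>
          iso g U (\<pi> U x) = \<pi> (act g U) (g \<otimes> x)"
    and iso_rho: "\<And>g U V. \<lbrakk>g \<in> carrier G; U \<in> \<SS>; V \<in> \<SS>; U \<prec> V \<or> transverse U V\<rbrakk> \<Longrightarrow>
          iso g V ` \<rho> U V = \<rho> (act g U) (act g V)"


section \<open>Conjugacy classes of subgroups\<close>

definition subgroup_conj_class :: "('g, 'm) monoid_scheme \<Rightarrow> 'g set \<Rightarrow> 'g set set" where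
  "subgroup_conj_class G H = {g <#\<^bsub>G\<^esub> H #>\<^bsub>G\<^esub> inv\<^bsub>G\<^esub> g | g. g \<in> carrier G}"

end

theory Submission
  imports Defs
begin

text \<open>
  By left invariance it suffices to find, for every finite subgroup \<open>H\<close>, an element \<open>y\<close> with
  \<open>d(y, hy)\<close> bounded independently of \<open>H\<close>: then a conjugate of \<open>H\<close> lies in a fixed ball. By
  uniqueness, \<open>d(y, hy)\<close> need only be bounded in every domain.

  Let \<open>F\<close> be a neighbourhood of \<open>H\<close> in the Cayley graph that is finite, connected and invariant
  under \<open>H\<close>. In each hyperbolic space \<open>\<C> U\<close> consider the medians of the projection of \<open>F\<close>: the
  points close to the hull of every subset that contains more than half of \<open>F\<close>. Such hulls meet
  pairwise, so medians exist by Helly's theorem, and since \<open>F\<close> is connected they are unique up to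
  a bounded error. Majorities also make the tuple of medians consistent: if the median in \<open>U\<close> is
  far from \<open>\<rho>\<^sup>V\<^sub>U\<close>, then so is half of \<open>F\<close>, which therefore projects close to \<open>\<rho>\<^sup>U\<^sub>V\<close>. A point
  \<open>y\<close> realising this tuple is almost fixed by \<open>H\<close>, because \<open>H\<close> preserves \<open>F\<close> and hence permutes
  the medians.
\<close>

section \<open>Gromov hyperbolicity\<close>

definition gromov_product :: "'a metric \<Rightarrow> 'a \<Rightarrow> 'a \<Rightarrow> 'a \<Rightarrow> real" where
  "gromov_product m w x y = (mdist m x w + mdist m y w - mdist m x y) / 2"

definition four_point_hyperbolic :: "'a metric \<Rightarrow> real \<Rightarrow> bool" where
  "four_point_hyperbolic m \<delta> \<longleftrightarrow>
     (\<forall>w\<in>mspace m. \<forall>x\<in>mspace m. \<forall>y\<in>mspace m. \<forall>z\<in>mspace m.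
        min (gromov_product m w x y) (gromov_product m w y z) \<le> gromov_product m w x z + \<delta>)"

lemma gromov_product_commute: "gromov_product m w x y = gromov_product m w y x"
  by (simp add: gromov_product_def mdist_commute)

lemma mdist_self: "x \<in> mspace m \<Longrightarrow> mdist m x x = 0"
  by simp

lemma gromov_product_self: "x \<in> mspace m \<Longrightarrow> gromov_product m w x x = mdist m x w"
  by (simp add: gromov_product_def)

lemma mdist_le_gromov_product: "mdist m b q \<le> mdist m x q + 2 * gromov_product m b x q"
  by (simp add: gromov_product_def mdist_commute field_simps)

lemma gromov_product_le_mdist:
  assumes "w \<in> mspace m" "x \<in> mspace m" "y \<in> mspace m"
  shows "gromov_product m w x y \<le> mdist m x w"
  using mdist_triangle[of y m x w] assms by (simp add: gromov_product_def mdist_commute)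

lemma gromov_product_change_base:
  "gromov_product m b u v =
     gromov_product m w u v + mdist m w b - gromov_product m w u b - gromov_product m w v b"
  by (simp add: gromov_product_def mdist_commute field_simps)

lemma four_point_hyperbolicD:
  assumes "four_point_hyperbolic m \<delta>"
    and "w \<in> mspace m" "x \<in> mspace m" "y \<in> mspace m" "z \<in> mspace m"
  shows "gromov_product m w x y \<le> gromov_product m w x z + \<delta> \<or>
    gromov_product m w y z \<le> gromov_product m w x z + \<delta>"
  using assms unfolding four_point_hyperbolic_def min_le_iff_disj by blast

lemma geodesic_segmentE:
  assumes "geodesic_segment m x y \<gamma>"
  obtains c L where "0 \<le> L" "c ` {0..L} \<subseteq> mspace m" "c 0 = x" "c L = y" "\<gamma> = c ` {0..L}"
    "\<And>s t. s \<in> {0..L} \<Longrightarrow> t \<in> {0..L} \<Longrightarrow> mdist m (c s) (c t) = \<bar>s - t\<bar>"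
  using assms unfolding geodesic_segment_def by blast

lemma hyperbolic_spaceD:
  assumes "hyperbolic_space m E" "geodesic_segment m x y \<alpha>" "geodesic_segment m y z \<beta>"
    "geodesic_segment m x z \<gamma>" "p \<in> \<alpha>"
  shows "\<exists>q\<in>\<beta> \<union> \<gamma>. mdist m p q \<le> E"
  using assms(1)[unfolded hyperbolic_space_def, rule_format, OF _ assms(5)] assms(2-4) by simp

lemma geodesic_segment_mdist:
  assumes "geodesic_segment m x y \<gamma>" "p \<in> \<gamma>"
  shows "p \<in> mspace m" "x \<in> mspace m" "y \<in> mspace m" "mdist m x p + mdist m p y = mdist m x y"
proof -
  obtain c L where c: "0 \<le> L" "c ` {0..L} \<subseteq> mspace m" "c 0 = x" "c L = y" "\<gamma> = c ` {0..L}"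
    "\<And>s t. s \<in> {0..L} \<Longrightarrow> t \<in> {0..L} \<Longrightarrow> mdist m (c s) (c t) = \<bar>s - t\<bar>"
    using geodesic_segmentE[OF assms(1)] by metis
  obtain t where t: "t \<in> {0..L}" "p = c t" using assms(2) c(5) by blast
  show "p \<in> mspace m" "x \<in> mspace m" "y \<in> mspace m"
    using c t by (auto simp: image_subset_iff)
  show "mdist m x p + mdist m p y = mdist m x y"
    using c(6)[of 0 t] c(6)[of t L] c(6)[of 0 L] c(1) t by (simp add: c(3,4))
qed

lemma gromov_product_le_geodesic:
  assumes "geodesic_segment m x y \<gamma>" "p \<in> \<gamma>" "w \<in> mspace m"
  shows "gromov_product m w x y \<le> mdist m p w"
  using geodesic_segment_mdist[OF assms(1,2)] mdist_triangle[of x m p w] mdist_triangle[of y m p w]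
    assms(3) by (simp add: gromov_product_def mdist_commute)

text \<open>Connectedness of the interval for sets that may fail to be closed: a point just beyond
  the supremum of \<open>P\<close> must lie in \<open>Q\<close>, and \<open>P\<close> comes
  arbitrarily close to that supremum.\<close>

lemma interval_cover_close:
  fixes L \<epsilon> :: real
  assumes "0 \<le> L" "\<epsilon> > 0" "{0..L} \<subseteq> P \<union> Q" "0 \<in> P" "L \<in> Q"
  obtains s t where "s \<in> P" "t \<in> Q" "s \<in> {0..L}" "t \<in> {0..L}" "\<bar>s - t\<bar> \<le> \<epsilon>"
proof -
  let ?P = "P \<inter> {0..L}"
  define u where "u = Sup ?P"
  have ne: "?P \<noteq> {}" and bdd: "bdd_above ?P" using assms(1,4) by auto
  have u0: "0 \<le> u" "u \<le> L"
    unfolding u_def using assms(1,4) bdd by (auto intro!: cSup_upper cSup_least)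
  obtain s where s: "s \<in> ?P" "u - \<epsilon> / 2 < s"
    using less_cSupD[OF ne, of "u - \<epsilon> / 2"] assms(2) by (auto simp: u_def)
  have su: "s \<le> u" unfolding u_def by (rule cSup_upper[OF s(1) bdd])
  define t where "t = min L (u + \<epsilon> / 2)"
  have "t \<in> Q"
  proof (cases "t = L")
    case False
    then have "t = u + \<epsilon> / 2" by (simp add: t_def min_def split: if_splits)
    then have "t \<notin> ?P" using cSup_upper[OF _ bdd, of t] assms(2) by (auto simp: u_def)
    moreover have "t \<in> {0..L}" using u0 assms(1,2) by (auto simp: t_def)
    ultimately show ?thesis using assms(3) by auto
  qed (use assms in simp)
  moreover have "t \<in> {0..L}" "\<bar>s - t\<bar> \<le> \<epsilon>" using u0 assms(1,2) s su by (auto simp: t_def)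
  ultimately show ?thesis using that s by blast
qed

text \<open>By thinness every point of \<open>\<gamma>\<close> is \<open>E\<close>-close to one of
  the other two sides. Where the side at \<open>x\<close> gives way to the side at \<open>y\<close>,
  a point is nearly close to both; adding the two estimates produces the Gromov product.\<close>

lemma geodesic_near_gromov_product:
  assumes geo: "geodesic_space m" and hyp: "hyperbolic_space m E" and E: "E \<ge> 1"
    and \<gamma>: "geodesic_segment m x y \<gamma>" and w: "w \<in> mspace m"
  shows "\<exists>p\<in>\<gamma>. mdist m p w \<le> gromov_product m w x y + 3 * E"
proof -
  obtain c L where c: "0 \<le> L" "c ` {0..L} \<subseteq> mspace m" "c 0 = x" "c L = y" "\<gamma> = c ` {0..L}"
    "\<And>s t. s \<in> {0..L} \<Longrightarrow> t \<in> {0..L} \<Longrightarrow> mdist m (c s) (c t) = \<bar>s - t\<bar>"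
    using geodesic_segmentE[OF \<gamma>] by metis
  have c_in: "c t \<in> mspace m" if "t \<in> {0..L}" for t using c(2) that by auto
  have x: "x \<in> mspace m" and y: "y \<in> mspace m" using c_in[of 0] c_in[of L] c(1,3,4) by auto
  obtain \<alpha> \<beta> where \<alpha>: "geodesic_segment m x w \<alpha>" and \<beta>: "geodesic_segment m y w \<beta>"
    using geo w x y unfolding geodesic_space_def by meson
  define near where "near \<sigma> = {t \<in> {0..L}. \<exists>q\<in>\<sigma>. mdist m (c t) q \<le> E}" for \<sigma>
  have nearD: "mdist m w (c t) + mdist m (c t) z \<le> mdist m z w + 2 * E"
    if t: "t \<in> near \<sigma>" and \<sigma>: "geodesic_segment m z w \<sigma>" for t z \<sigma>
  proof -
    obtain q where q: "q \<in> \<sigma>" "mdist m (c t) q \<le> E" and tL: "t \<in> {0..L}"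
      using t by (auto simp: near_def)
    note g = geodesic_segment_mdist[OF \<sigma> q(1)]
    show ?thesis
      using g q(2) mdist_triangle[OF w g(1) c_in[OF tL]] mdist_triangle[OF c_in[OF tL] g(1) g(2)]
      by (simp add: mdist_commute)
  qed
  have ends: "x \<in> \<alpha>" "y \<in> \<beta>"
    using \<alpha> \<beta> unfolding geodesic_segment_def by (auto intro!: rev_image_eqI[of 0])
  have tri: "\<exists>q\<in>\<beta> \<union> \<alpha>. mdist m p q \<le> E" if "p \<in> \<gamma>" for p
    using hyperbolic_spaceD[OF hyp \<gamma> \<beta> \<alpha> that] .
  have cover: "{0..L} \<subseteq> near \<alpha> \<union> near \<beta>"
    using tri unfolding c(5) near_def by auto
  have "mdist m (c 0) x \<le> E" "mdist m (c L) y \<le> E"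
    using c(6)[of 0 0] c(6)[of L L] c(1,3,4) E by auto
  then have "0 \<in> near \<alpha>" "L \<in> near \<beta>"
    unfolding near_def using ends c(1) by (metis (mono_tags, lifting) CollectI atLeastAtMost_iff order_refl)+
  with interval_cover_close[OF c(1) _ cover, of E] E
  obtain s t where st: "s \<in> near \<alpha>" "t \<in> near \<beta>" "s \<in> {0..L}" "t \<in> {0..L}" "\<bar>s - t\<bar> \<le> E"
    by auto
  have "mdist m w (c s) \<le> mdist m w (c t) + E" "mdist m (c s) y \<le> mdist m (c t) y + E"
    using mdist_triangle[OF w c_in[OF st(4)] c_in[OF st(3)]]
      mdist_triangle[OF c_in[OF st(3)] c_in[OF st(4)] y] c(6)[OF st(3,4)] st(5)
    by (auto simp: mdist_commute)
  then have "2 * mdist m (c s) w + mdist m x y \<le> mdist m x w + mdist m y w + 6 * E"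
    using nearD[OF st(1) \<alpha>] nearD[OF st(2) \<beta>] mdist_triangle[OF x c_in[OF st(3)] y]
    by (simp add: mdist_commute)
  then show ?thesis
    using st(3) unfolding c(5) gromov_product_def by (auto simp: field_simps intro!: bexI[of _ s])
qed

text \<open>A point on the side from \<open>x\<close> to \<open>z\<close> attains their product up
  to \<open>3 * E\<close>. Thinness moves it by \<open>E\<close> to another side, where its distance
  from \<open>w\<close> is at least the product of the ends of that side.\<close>

lemma hyperbolic_space_four_point:
  assumes geo: "geodesic_space m" and hyp: "hyperbolic_space m E" and E: "E \<ge> 1"
  shows "four_point_hyperbolic m (4 * E)"
  unfolding four_point_hyperbolic_def
proof (intro ballI)
  fix w x y z
  assume in_m: "w \<in> mspace m" "x \<in> mspace m" "y \<in> mspace m" "z \<in> mspace m"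
  obtain \<alpha> \<beta> \<gamma> where seg: "geodesic_segment m x z \<alpha>" "geodesic_segment m z y \<beta>"
      "geodesic_segment m x y \<gamma>"
    using geo in_m unfolding geodesic_space_def by meson
  obtain p where p: "p \<in> \<alpha>" "mdist m p w \<le> gromov_product m w x z + 3 * E"
    using geodesic_near_gromov_product[OF geo hyp E seg(1) in_m(1)] by blast
  obtain q where q: "q \<in> \<beta> \<union> \<gamma>" "mdist m p q \<le> E"
    using hyperbolic_spaceD[OF hyp seg p(1)] by (elim bexE)
  have "q \<in> mspace m" "p \<in> mspace m"
    using q(1) geodesic_segment_mdist(1)[OF seg(1) p(1)] geodesic_segment_mdist(1)[OF seg(2)]
      geodesic_segment_mdist(1)[OF seg(3)] by auto
  then have "mdist m q w \<le> gromov_product m w x z + 4 * E"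
    using mdist_triangle[of q m p w] in_m(1) p(2) q(2) by (simp add: mdist_commute)
  moreover have "gromov_product m w x y \<le> mdist m q w \<or> gromov_product m w y z \<le> mdist m q w"
    using q(1) gromov_product_le_geodesic[OF seg(2) _ in_m(1), of q]
      gromov_product_le_geodesic[OF seg(3) _ in_m(1), of q]
    by (auto simp: gromov_product_commute[of m w y z])
  ultimately show
    "min (gromov_product m w x y) (gromov_product m w y z) \<le> gromov_product m w x z + 4 * E"
    by linarith
qed

section \<open>Medians of finite families in hyperbolic spaces\<close>

text \<open>A small Gromov product of \<open>f x\<close> and \<open>f y\<close> at \<open>b\<close>
  stands for \<open>b\<close> being near the hull of the majority. Majorities consist of indices, so
  points count with multiplicity.\<close>

definition median_center :: "'a metric \<Rightarrow> ('i \<Rightarrow> 'a) \<Rightarrow> 'i set \<Rightarrow> real \<Rightarrow> 'a \<Rightarrow> bool" where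
  "median_center m f F K b \<longleftrightarrow> b \<in> mspace m \<and>
     (\<forall>F'\<subseteq>F. card F < 2 * card F' \<longrightarrow> (\<exists>x\<in>F'. \<exists>y\<in>F'. gromov_product m b (f x) (f y) \<le> K))"

lemma majorities_meet:
  assumes "finite F" "P \<subseteq> F" "Q \<subseteq> F" "card F < card P + card Q"
  shows "P \<inter> Q \<noteq> {}"
proof
  assume "P \<inter> Q = {}"
  then have "card P + card Q = card (P \<union> Q)"
    using assms(1-3) by (simp add: card_Un_disjoint finite_subset)
  also have "\<dots> \<le> card F" using assms by (intro card_mono) auto
  finally show False using assms(4) by simp
qed

text \<open>
  Helly's theorem for the hulls of the strict majorities: among these hulls choose one that is
  farthest from a base point \<open>w\<close>, and let \<open>b\<close> be its point nearest to \<open>w\<close>. Any other majority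
  meets the chosen one, hence its hull passes close to \<open>b\<close>.
\<close>

lemma median_center_exists:
  fixes f :: "'i \<Rightarrow> 'a"
  assumes geo: "geodesic_space m" and hyp: "hyperbolic_space m E" and E: "E \<ge> 1"
    and F: "finite F" "F \<noteq> {}" and f: "f ` F \<subseteq> mspace m"
  shows "\<exists>b. median_center m f F (22 * E) b"
proof -
  obtain w0 where "w0 \<in> F" using F by blast
  define w where "w = f w0"
  have w: "w \<in> mspace m" using f \<open>w0 \<in> F\<close> by (auto simp: w_def)
  let ?g = "\<lambda>(x, y). gromov_product m w (f x) (f y)"
  define maj where "maj = {F'. F' \<subseteq> F \<and> card F < 2 * card F'}"
  have fin: "finite (?g ` (F' \<times> F'))" "?g ` (F' \<times> F') \<noteq> {}" if "F' \<in> maj" for F'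
    using that F(1) finite_subset[of F' F] by (auto simp: maj_def)
  \<comment> \<open>Coarsely the distance from \<open>w\<close> to the hull of
    \<open>F'\<close>.\<close>
  define h where "h F' = Min (?g ` (F' \<times> F'))" for F'
  have h_le: "h F' \<le> gromov_product m w (f x) (f y)" if "F' \<in> maj" "x \<in> F'" "y \<in> F'" for F' x y
    unfolding h_def using that by (intro Min_le fin) auto
  have h_attained: "\<exists>x\<in>F'. \<exists>y\<in>F'. h F' = gromov_product m w (f x) (f y)" if "F' \<in> maj" for F'
    using Min_in[OF fin[OF that]] unfolding h_def by auto
  have "F \<in> maj" "finite maj" using F by (auto simp: maj_def card_gt_0_iff)
  then have "Max (h ` maj) \<in> h ` maj" by (intro Max_in) auto
  then obtain A where A: "A \<in> maj" "\<And>F'. F' \<in> maj \<Longrightarrow> h F' \<le> h A"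
    using \<open>finite maj\<close> by (metis (no_types, lifting) Max_ge finite_imageI imageE imageI)
  obtain x y where xy: "x \<in> A" "y \<in> A" "h A = gromov_product m w (f x) (f y)"
    using h_attained[OF A(1)] by blast
  have AF: "A \<subseteq> F" using A(1) by (simp add: maj_def)
  have f_in: "f z \<in> mspace m" if "z \<in> F" for z using that f by auto
  have fxy: "f x \<in> mspace m" "f y \<in> mspace m" using f_in xy AF by auto
  obtain \<gamma> where \<gamma>: "geodesic_segment m (f x) (f y) \<gamma>"
    using geo fxy unfolding geodesic_space_def by blast
  obtain b where b: "b \<in> \<gamma>" "mdist m b w \<le> h A + 3 * E"
    using geodesic_near_gromov_product[OF geo hyp E \<gamma> w] xy(3) by auto
  note bm = geodesic_segment_mdist[OF \<gamma> b(1)]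
  have ob: "h A \<le> mdist m w b"
    using gromov_product_le_geodesic[OF \<gamma> b(1) w] xy(3) by (simp add: mdist_commute)
  note four = four_point_hyperbolicD[OF hyperbolic_space_four_point[OF geo hyp E]]
  note base = gromov_product_change_base[of m b _ _ w]
  have "gromov_product m b (f x) (f y) = 0"
    using bm(4) by (simp add: gromov_product_def mdist_commute)
  moreover have "gromov_product m w (f y) b \<le> mdist m w b"
    using gromov_product_le_mdist[OF w bm(1) fxy(2)] by (simp add: gromov_product_commute mdist_commute)
  ultimately have xb: "h A \<le> gromov_product m w (f x) b"
    using base[of "f x" "f y"] xy(3) by simp
  \<comment> \<open>Seen from \<open>w\<close>, all of \<open>A\<close> lies beyond
    \<open>b\<close>: the products of \<open>z\<close> with \<open>x\<close> and of \<open>x\<close>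
    with \<open>b\<close> are at least \<open>h A\<close>.\<close>
  have zb: "mdist m w b - 7 * E \<le> gromov_product m w (f z) b" if "z \<in> A" for z
    using four[OF w f_in[OF subsetD[OF AF that]] fxy(1) bm(1)] xb h_le[OF A(1) that xy(1)] b(2)
    unfolding mdist_commute[of m w b] by linarith
  \<comment> \<open>Either \<open>b\<close> is already near the hull of \<open>u\<close> and
    \<open>z\<close>, or \<open>u\<close> lies beyond \<open>b\<close> as well.\<close>
  have step: "gromov_product m b (f u) (f z) \<le> 22 * E \<or>
      mdist m w b - 11 * E \<le> gromov_product m w (f u) b" if "z \<in> A" "u \<in> F" for z u
    using four[OF w f_in[OF that(2)] f_in[OF subsetD[OF AF that(1)]] bm(1)]
      base[of "f u" "f z"] zb[OF that(1)] E by linarith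
  have "\<exists>x\<in>F'. \<exists>y\<in>F'. gromov_product m b (f x) (f y) \<le> 22 * E"
    if F': "F' \<subseteq> F" "card F < 2 * card F'" for F'
  proof -
    have maj': "F' \<in> maj" using F' by (simp add: maj_def)
    obtain z where z: "z \<in> A" "z \<in> F'"
      using majorities_meet[OF F(1) AF F'(1)] F'(2) A(1) by (auto simp: maj_def)
    obtain u v where uv: "u \<in> F'" "v \<in> F'" "h F' = gromov_product m w (f u) (f v)"
      using h_attained[OF maj'] by blast
    \<comment> \<open>If \<open>u\<close> and \<open>v\<close> both lie beyond \<open>b\<close>,
      then \<open>h F' \<le> h A\<close> and \<open>h A \<le> mdist m w b\<close> leave only the two
      errors of \<open>11 * E\<close>. Otherwise \<open>z\<close> together with \<open>u\<close> or
      \<open>v\<close> is the required pair.\<close>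
    have "gromov_product m b (f u) (f v) \<le> 22 * E"
      if "mdist m w b - 11 * E \<le> gromov_product m w (f u) b"
        "mdist m w b - 11 * E \<le> gromov_product m w (f v) b"
      using base[of "f u" "f v"] that uv(3) A(2)[OF maj'] ob by linarith
    then show ?thesis using step[OF z(1)] uv z(2) F'(1) by blast
  qed
  then show ?thesis using bm(1) unfolding median_center_def by blast
qed

text \<open>A strict majority meets the half \<open>P\<close> in some \<open>x\<close>, and the
  product of \<open>f x\<close> with itself at \<open>r\<close> is just the distance from
  \<open>f x\<close> to \<open>r\<close>.\<close>

lemma median_center_of_half:
  assumes "finite F" "P \<subseteq> F" "card F \<le> 2 * card P" "r \<in> mspace m" "f ` F \<subseteq> mspace m"
    and "\<And>x. x \<in> P \<Longrightarrow> mdist m (f x) r \<le> K"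
  shows "median_center m f F K r"
  unfolding median_center_def
proof (intro conjI allI impI)
  fix F' assume F': "F' \<subseteq> F" "card F < 2 * card F'"
  then obtain x where "x \<in> F'" "x \<in> P"
    using majorities_meet[OF assms(1) F'(1) assms(2)] assms(3) by auto
  then show "\<exists>x\<in>F'. \<exists>y\<in>F'. gromov_product m r (f x) (f y) \<le> K"
    using assms F'(1) by (intro bexI[of _ x]) (auto simp: gromov_product_self image_subset_iff)
qed (use assms in auto)

text \<open>By the four-point inequality, two points whose products with \<open>q\<close> are at
  least \<open>s\<close> have a product above \<open>K\<close>; so such points cannot form a strict
  majority.\<close>

lemma median_center_half_space:
  assumes hyp: "four_point_hyperbolic m \<delta>" and b: "median_center m f F K b"
    and F: "finite F" "f ` F \<subseteq> mspace m" and q: "q \<in> mspace m" and s: "K + \<delta> < s"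
  shows "2 * card {x \<in> F. s \<le> gromov_product m b (f x) q} \<le> card F"
proof (rule ccontr)
  let ?P = "{x \<in> F. s \<le> gromov_product m b (f x) q}"
  assume "\<not> 2 * card ?P \<le> card F"
  then obtain x y where xy: "x \<in> ?P" "y \<in> ?P" "gromov_product m b (f x) (f y) \<le> K"
    using b unfolding median_center_def by (auto dest!: spec[of _ ?P])
  have "b \<in> mspace m" using b by (simp add: median_center_def)
  then show False
    using four_point_hyperbolicD[OF hyp, of b "f x" q "f y"] xy F(2) q s
    by (auto simp: image_subset_iff gromov_product_commute[of m b q])
qed

lemma median_center_half:
  assumes hyp: "four_point_hyperbolic m \<delta>" and b: "median_center m f F K b"
    and F: "finite F" "f ` F \<subseteq> mspace m" and q: "q \<in> mspace m" and s: "K + \<delta> < s"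
  shows "\<exists>P\<subseteq>F. card F \<le> 2 * card P \<and> (\<forall>x\<in>P. gromov_product m b (f x) q < s)"
proof (intro exI conjI)
  let ?Q = "{x \<in> F. s \<le> gromov_product m b (f x) q}"
  show "card F \<le> 2 * card (F - ?Q)"
    using median_center_half_space[OF assms] F(1) by (subst card_Diff_subset) auto
qed auto

text \<open>
  If \<open>b\<close> and \<open>b'\<close> are far apart, then exactly half of the family lies near \<open>b\<close>, half near \<open>b'\<close>
  and nothing in between, which a coarsely connected family does not allow.
\<close>

lemma median_center_unique:
  assumes hyp: "four_point_hyperbolic m \<delta>"
    and b: "median_center m f F K b" and b': "median_center m f F K b'"
    and F: "finite F" "F \<noteq> {}" "f ` F \<subseteq> mspace m"
    and connected: "\<And>P. P \<subseteq> F \<Longrightarrow> P \<noteq> {} \<Longrightarrow> P \<noteq> F \<Longrightarrow>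
          \<exists>x\<in>P. \<exists>y\<in>F - P. mdist m (f x) (f y) \<le> s" and s: "0 \<le> s"
  shows "mdist m b b' \<le> 2 * K + 2 * \<delta> + s"
proof (rule ccontr)
  let ?L = "mdist m b b'"
  \<comment> \<open>A quarter of the excess over the claimed bound: the cut-offs exceed
    \<open>K + \<delta>\<close> strictly, and \<open>s2 - s1\<close> is still
    \<open>s + 2 * \<eta>\<close>.\<close>
  define \<eta> where "\<eta> = (?L - 2 * K - 2 * \<delta> - s) / 4"
  assume "\<not> ?thesis"
  then have \<eta>: "\<eta> > 0" by (simp add: \<eta>_def)
  have bm: "b \<in> mspace m" "b' \<in> mspace m" using b b' by (auto simp: median_center_def)
  \<comment> \<open>Coarsely the position of \<open>f x\<close> on the way from \<open>b\<close> to
    \<open>b'\<close>.\<close>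
  define \<phi> where "\<phi> x = gromov_product m b (f x) b'" for x
  define s1 s2 where "s1 = K + \<delta> + \<eta>" and "s2 = ?L - (K + \<delta> + \<eta>)"
  have gap: "s2 - s1 > s" using \<eta> by (simp add: s1_def s2_def \<eta>_def field_simps)
  have \<phi>': "gromov_product m b' (f x) b = ?L - \<phi> x" for x
    by (simp add: \<phi>_def gromov_product_def mdist_commute field_simps)
  let ?P = "{x \<in> F. \<phi> x \<le> s2}" and ?Q = "{x \<in> F. s1 \<le> \<phi> x}"
  have Q: "2 * card ?Q \<le> card F"
    using median_center_half_space[OF hyp b F(1,3) bm(2), of s1] \<eta> by (simp add: s1_def \<phi>_def)
  have "2 * card {x \<in> F. K + \<delta> + \<eta> \<le> gromov_product m b' (f x) b} \<le> card F"
    using median_center_half_space[OF hyp b' F(1,3) bm(1), of "K + \<delta> + \<eta>"] \<eta> by simp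
  moreover have "{x \<in> F. K + \<delta> + \<eta> \<le> gromov_product m b' (f x) b} = ?P"
    unfolding \<phi>' s2_def by auto
  ultimately have P: "2 * card ?P \<le> card F" by simp
  show False
  proof -
    have "F = ?P \<union> ?Q" using gap s by auto
    then have "card F + card (?P \<inter> ?Q) = card ?P + card ?Q"
      using F(1) card_Un_Int[of ?P ?Q] by simp
    \<comment> \<open>Two sets of at most half the size that cover \<open>F\<close> are disjoint
      halves.\<close>
    then have "card (?P \<inter> ?Q) = 0" and PF: "2 * card ?P = card F"
      using P Q by linarith+
    moreover have "finite (?P \<inter> ?Q)" using F(1) by simp
    ultimately have "?P \<inter> ?Q = {}" by (simp only: card_0_eq)
    moreover have "?P \<noteq> {}"
    proof
      assume "?P = {}"
      then have "card F = 0" using PF by (metis card.empty mult_0_right)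
      then show False using F by simp
    qed
    moreover have "?P \<noteq> F"
    proof
      assume "?P = F"
      then have "2 * card F = card F" using PF by metis
      then show False using F by simp
    qed
    ultimately obtain x y where x: "x \<in> ?P" and y: "y \<in> F - ?P" and d: "mdist m (f x) (f y) \<le> s"
      using connected[of ?P] by auto
    have "\<phi> x < s1" "\<phi> y > s2" using x y \<open>?P \<inter> ?Q = {}\<close> by auto
    moreover have "\<phi> y \<le> \<phi> x + mdist m (f x) (f y)"
    proof -
      have "f x \<in> mspace m" "f y \<in> mspace m" using x y F(3) by auto
      from mdist_triangle[OF this(2,1) bm(1)] mdist_triangle[OF this bm(2)] show ?thesis
        unfolding \<phi>_def gromov_product_def mdist_commute[of m "f y" "f x"]
        by (simp add: field_simps)
    qed
    ultimately show False using d gap by linarith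
  qed
qed

section \<open>Consistency in terms of points\<close>

lemma set_dist_ge:
  assumes "A \<noteq> {}" "B \<noteq> {}" "\<And>a b. a \<in> A \<Longrightarrow> b \<in> B \<Longrightarrow> c \<le> mdist m a b"
  shows "c \<le> set_dist m A B"
  unfolding set_dist_def using assms by (intro cINF_greatest) auto

lemma set_dist_approx:
  assumes "A \<noteq> {}" "B \<noteq> {}" "set_dist m A B \<le> c" "\<epsilon> > 0"
  shows "\<exists>a\<in>A. \<exists>b\<in>B. mdist m a b \<le> c + \<epsilon>"
proof (rule ccontr)
  assume "\<not> ?thesis"
  then have "c + \<epsilon> \<le> set_dist m A B"
    using assms(1,2) by (intro set_dist_ge) force+
  then show False using assms(3,4) by simp
qed

lemma mdist_le_of_set_dist:
  assumes "set_dist m A B \<le> c" "diam_le m A r" "diam_le m B s" "A \<subseteq> mspace m" "B \<subseteq> mspace m"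
    and "a \<in> A" "b \<in> B"
  shows "mdist m a b \<le> c + r + s"
proof (rule field_le_epsilon)
  fix \<epsilon> :: real assume "0 < \<epsilon>"
  then obtain a' b' where ab: "a' \<in> A" "b' \<in> B" "mdist m a' b' \<le> c + \<epsilon>"
    using set_dist_approx[OF _ _ assms(1)] assms(6,7) by blast
  have "mdist m a a' \<le> r" "mdist m b' b \<le> s"
    using assms(2,3,6,7) ab unfolding diam_le_def by auto
  moreover have "a \<in> mspace m" "a' \<in> mspace m" "b \<in> mspace m" "b' \<in> mspace m"
    using assms(4-7) ab by auto
  ultimately show "mdist m a b \<le> c + r + s + \<epsilon>"
    using mdist_triangle[of a m a' b] mdist_triangle[of a' m b' b] ab(3) by simp
qed

context HHS
begin

text \<open>
  As the sets \<open>\<rho> U V\<close> have diameter at most \<open>E\<close>, each may be replaced by a single point at the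
  cost of tripling the constants of the axioms.
\<close>

definition rho_point :: "'u \<Rightarrow> 'u \<Rightarrow> 'c" where
  "rho_point U V = (SOME p. p \<in> \<rho> U V)"

lemma rho_set:
  assumes "U \<in> \<SS>" "V \<in> \<SS>" "pnest U V \<or> transverse U V"
  shows "\<rho> U V \<subseteq> mspace (\<C> V)" "diam_le (\<C> V) (\<rho> U V) E" "rho_point U V \<in> \<rho> U V"
    "rho_point U V \<in> mspace (\<C> V)"
proof -
  have *: "\<rho> U V \<noteq> {}" "\<rho> U V \<subseteq> mspace (\<C> V)" "diam_le (\<C> V) (\<rho> U V) E"
    using rho_nest rho_transverse assms by blast+
  then show "rho_point U V \<in> \<rho> U V" unfolding rho_point_def by (simp add: some_in_eq)
  with * show "\<rho> U V \<subseteq> mspace (\<C> V)" "diam_le (\<C> V) (\<rho> U V) E"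
    "rho_point U V \<in> mspace (\<C> V)" by auto
qed

lemma transverse_sym:
  assumes "U \<in> \<SS>" "V \<in> \<SS>" "transverse U V" shows "transverse V U"
  using assms orth_sym unfolding transverse_def comparable_def symp_on_def by blast

lemma pi_in: "U \<in> \<SS> \<Longrightarrow> x \<in> mspace X \<Longrightarrow> \<pi> U x \<in> mspace (\<C> U)"
  using proj_maps by blast

lemma mdist_rho_point_le:
  assumes "U \<in> \<SS>" "V \<in> \<SS>" "pnest U V \<or> transverse U V" "p \<in> mspace (\<C> V)"
    and "set_dist (\<C> V) {p} (\<rho> U V) \<le> E"
  shows "mdist (\<C> V) p (rho_point U V) \<le> 3 * E"
  using mdist_le_of_set_dist[OF assms(5), of E E p] rho_set[OF assms(1-3)] assms(4) E_ge_1
  by (auto simp: diam_le_def mdist_self)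

lemma rho_point_transverse:
  assumes "U \<in> \<SS>" "V \<in> \<SS>" "transverse U V" "x \<in> mspace X"
  shows "mdist (\<C> U) (\<pi> U x) (rho_point V U) \<le> 3 * E \<or>
    mdist (\<C> V) (\<pi> V x) (rho_point U V) \<le> 3 * E"
  using consistency_transverse[OF assms] mdist_rho_point_le transverse_sym assms pi_in
  unfolding min_le_iff_disj by meson

lemma rho_point_nest:
  assumes "U \<in> \<SS>" "V \<in> \<SS>" "pnest U V" "x \<in> mspace X"
  shows "mdist (\<C> V) (\<pi> V x) (rho_point U V) \<le> 3 * E \<or>
    mdist (\<C> U) (\<pi> U x) (\<rho>map V U (\<pi> V x)) \<le> 3 * E"
  using consistency_nest[OF assms] mdist_rho_point_le[of U V "\<pi> V x"] assms pi_in E_ge_1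
  by (auto simp: diam_le_def)

text \<open>The first conclusion gives \<open>rho_point U W\<close> a meaning; it holds because
  \<open>W \<preceq> U\<close> would imply \<open>W \<preceq> V\<close>.\<close>

lemma rho_point_nested_close:
  assumes "U \<in> \<SS>" "V \<in> \<SS>" "W \<in> \<SS>" "U \<preceq> V" "pnest V W \<or> transverse V W" "\<not> orth W U"
  shows "pnest U W \<or> transverse U W"
    and "mdist (\<C> W) (rho_point U W) (rho_point V W) \<le> 3 * E"
proof -
  have "U \<noteq> W" "\<not> W \<preceq> U"
    using assms nest_trans nest_antisym
    unfolding pnest_def transverse_def comparable_def transp_on_def antisymp_on_def by blast+
  then show UW: "pnest U W \<or> transverse U W"
    using assms(1,3,6) orth_sym unfolding pnest_def transverse_def comparable_def symp_on_def by blast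
  have "set_dist (\<C> W) (\<rho> U W) (\<rho> V W) \<le> E"
    using consistency_rho assms by blast
  then show "mdist (\<C> W) (rho_point U W) (rho_point V W) \<le> 3 * E"
    using mdist_le_of_set_dist[of "\<C> W" "\<rho> U W" "\<rho> V W" E E E] rho_set[OF assms(1,3) UW]
      rho_set[OF assms(2,3,5)] by auto
qed

text \<open>Bounded geodesic image in terms of Gromov products: the product at a point is a lower
  bound for its distance from any geodesic between \<open>p\<close> and \<open>q\<close>.\<close>

lemma rho_map_close:
  assumes UV: "U \<in> \<SS>" "V \<in> \<SS>" "pnest U V" and pq: "p \<in> mspace (\<C> V)" "q \<in> mspace (\<C> V)"
    and far: "3 * E < gromov_product (\<C> V) (rho_point U V) p q"
  shows "mdist (\<C> U) (\<rho>map V U p) (\<rho>map V U q) \<le> 3 * E"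
proof -
  note rho = rho_set[OF UV(1,2) disjI1[OF UV(3)]]
  obtain \<gamma> where \<gamma>: "geodesic_segment (\<C> V) p q \<gamma>"
    using geodesic[OF UV(2)] pq unfolding geodesic_space_def by blast
  then have ends: "p \<in> \<gamma>" "q \<in> \<gamma>"
    unfolding geodesic_segment_def by force+
  \<comment> \<open>Passing from the point to the set costs \<open>E\<close>, and
    \<open>2 * E\<close> still exceeds the threshold \<open>E\<close> of the axiom.\<close>
  have "2 * E \<le> set_dist (\<C> V) \<gamma> (\<rho> U V)"
  proof (rule set_dist_ge)
    fix a b assume ab: "a \<in> \<gamma>" "b \<in> \<rho> U V"
    have "3 * E < mdist (\<C> V) a (rho_point U V)"
      using gromov_product_le_geodesic[OF \<gamma> ab(1) rho(4)] far by linarith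
    moreover have "mdist (\<C> V) b (rho_point U V) \<le> E"
      using rho(2,3) ab(2) unfolding diam_le_def by blast
    ultimately show "2 * E \<le> mdist (\<C> V) a b"
      using mdist_triangle[of a "\<C> V" b "rho_point U V"] geodesic_segment_mdist(1)[OF \<gamma> ab(1)]
        rho(1,4) ab(2) by auto
  qed (use ends rho in auto)
  then have "diam_le (\<C> U) (\<rho>map V U ` \<gamma>) E"
    using bounded_geodesic_image[OF UV \<gamma>] E_ge_1 by simp
  then show ?thesis using ends E_ge_1 unfolding diam_le_def by fastforce
qed

section \<open>Realisation of consistent tuples\<close>

text \<open>The projections of a point of \<open>X\<close> form such a tuple with
  \<open>\<kappa> = 3 * E\<close>.\<close>

definition consistent_tuple :: "real \<Rightarrow> ('u \<Rightarrow> 'c) \<Rightarrow> bool" where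
  "consistent_tuple \<kappa> b \<longleftrightarrow>
     (\<forall>U\<in>\<SS>. b U \<in> mspace (\<C> U)) \<and>
     (\<forall>U\<in>\<SS>. \<forall>V\<in>\<SS>. transverse U V \<longrightarrow>
        mdist (\<C> U) (b U) (rho_point V U) \<le> \<kappa> \<or> mdist (\<C> V) (b V) (rho_point U V) \<le> \<kappa>) \<and>
     (\<forall>U\<in>\<SS>. \<forall>V\<in>\<SS>. pnest U V \<longrightarrow>
        mdist (\<C> V) (b V) (rho_point U V) \<le> \<kappa> \<or> mdist (\<C> U) (b U) (\<rho>map V U (b V)) \<le> \<kappa>)"

definition partially_realises :: "('u \<Rightarrow> 'c) \<Rightarrow> 'u set \<Rightarrow> 'x \<Rightarrow> bool" where
  "partially_realises b \<U> y \<longleftrightarrow> y \<in> mspace X \<and>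
     (\<forall>U\<in>\<U>. mdist (\<C> U) (\<pi> U y) (b U) \<le> E \<and>
        (\<forall>V\<in>\<SS>. pnest U V \<or> transverse U V \<longrightarrow> mdist (\<C> V) (\<pi> V y) (rho_point U V) \<le> 3 * E))"

lemma partial_realisation_point:
  assumes "\<U> \<subseteq> \<SS>" "pairwise orth \<U>" "\<And>U. U \<in> \<SS> \<Longrightarrow> b U \<in> mspace (\<C> U)"
  shows "\<exists>y. partially_realises b \<U> y"
proof -
  obtain y where y: "y \<in> mspace X" "\<And>U. U \<in> \<U> \<Longrightarrow> mdist (\<C> U) (\<pi> U y) (b U) \<le> E"
    "\<And>U V. U \<in> \<U> \<Longrightarrow> V \<in> \<SS> \<Longrightarrow> pnest U V \<or> transverse U V \<Longrightarrow>
       set_dist (\<C> V) {\<pi> V y} (\<rho> U V) \<le> E"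
    using partial_realisation[OF assms(1,2), of b] assms(1,3) by blast
  then have "partially_realises b \<U> y"
    unfolding partially_realises_def using mdist_rho_point_le pi_in assms(1) by blast
  then show ?thesis by blast
qed

text \<open>One point realises both orthogonal domains, and its projection to \<open>V\<close> is
  close to both rho points.\<close>

lemma rho_points_of_orthogonal_close:
  assumes UVW: "U \<in> \<SS>" "V \<in> \<SS>" "W \<in> \<SS>" and "orth U W" "transverse U V" "transverse W V"
    and p: "\<And>U. U \<in> \<SS> \<Longrightarrow> b U \<in> mspace (\<C> U)"
  shows "mdist (\<C> V) (rho_point U V) (rho_point W V) \<le> 6 * E"
proof -
  have "pairwise orth {U, W}"
    using assms(1,3,4) orth_sym unfolding pairwise_def symp_on_def by blast
  then obtain z where z: "partially_realises b {U, W} z"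
    using partial_realisation_point[of "{U, W}" b] p UVW by auto
  then have "mdist (\<C> V) (\<pi> V z) (rho_point U V) \<le> 3 * E"
    "mdist (\<C> V) (\<pi> V z) (rho_point W V) \<le> 3 * E" "z \<in> mspace X"
    using assms unfolding partially_realises_def by auto
  then show ?thesis
    using mdist_triangle[of "rho_point U V" "\<C> V" "\<pi> V z" "rho_point W V"]
      rho_set(4) pi_in assms by (auto simp: mdist_commute)
qed

text \<open>
  For transverse domains \<open>V\<close>, \<open>W\<close> in which \<open>x\<close> and \<open>b\<close> are far apart, \<open>b V\<close> being close to
  \<open>rho_point W V\<close> says that a path from \<open>x\<close> to \<open>b\<close> crosses \<open>V\<close> before \<open>W\<close>. The domain that we
  want is one crossed last.
\<close>

lemma last_discrepancy:
  assumes b: "consistent_tuple \<kappa> b" and \<kappa>: "3 * E \<le> \<kappa>" and L: "2 * \<kappa> + 12 * E < L"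
    and x: "x \<in> mspace X" and D: "D \<subseteq> \<SS>"
    and B: "B = {W \<in> D. L < mdist (\<C> W) (\<pi> W x) (b W)}" and fin: "finite B" and ne: "B \<noteq> {}"
  shows "\<exists>V\<in>B. \<forall>W\<in>D. pnest V W \<or> transverse V W \<longrightarrow>
    mdist (\<C> W) (b W) (rho_point V W) \<le> L + \<kappa> + 3 * E"
proof -
  have b_in: "b U \<in> mspace (\<C> U)" if "U \<in> \<SS>" for U
    using b that unfolding consistent_tuple_def by blast
  have b_trans: "mdist (\<C> U) (b U) (rho_point V U) \<le> \<kappa> \<or> mdist (\<C> V) (b V) (rho_point U V) \<le> \<kappa>"
    if "U \<in> \<SS>" "V \<in> \<SS>" "transverse U V" for U V
    using b that unfolding consistent_tuple_def by blast
  have BS: "B \<subseteq> \<SS>" and BD: "B \<subseteq> D" using B D by auto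
  have far: "L < mdist (\<C> W) (\<pi> W x) (b W)" if "W \<in> B" for W using B that by simp
  have tri: "mdist (\<C> W) p r \<le> mdist (\<C> W) p q + mdist (\<C> W) r q"
    if "p \<in> mspace (\<C> W)" "q \<in> mspace (\<C> W)" "r \<in> mspace (\<C> W)" for W p q r
    using mdist_triangle[OF that] by (simp add: mdist_commute)
  have split: "L - c < mdist (\<C> W) (\<pi> W x) p"
    if "W \<in> B" "mdist (\<C> W) (b W) p \<le> c" "p \<in> mspace (\<C> W)" for W p c
    using tri[OF pi_in that(3) b_in] BS that far[OF that(1)] x by fastforce
  have split': "L - c < mdist (\<C> W) (b W) p"
    if "W \<in> B" "mdist (\<C> W) (\<pi> W x) p \<le> c" "p \<in> mspace (\<C> W)" for W p c
    using tri[OF pi_in that(3) b_in] BS that far[OF that(1)] x by fastforce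
  \<comment> \<open>No two members of \<open>M\<close> are properly nested, so distinct ones are
    orthogonal or transverse.\<close>
  define M where "M = {V \<in> B. \<forall>W\<in>B. \<not> pnest V W}"
  have pnest_asym: "asymp_on \<SS> pnest"
    using nest_antisym unfolding asymp_on_def antisymp_on_def pnest_def by blast
  have pnest_trans: "transp_on \<SS> pnest"
    using nest_antisym nest_trans unfolding antisymp_on_def pnest_def transp_on_def by metis
  have above: "\<exists>W'\<in>M. W \<preceq> W'" if W: "W \<in> B" for W
  proof -
    have "W \<preceq> W" using W nest_refl BS by (auto simp: reflp_on_def)
    then obtain W' where W': "W' \<in> B" "W \<preceq> W'" "\<And>V. V \<in> B \<Longrightarrow> pnest W' V \<Longrightarrow> \<not> W \<preceq> V"
      using Finite_Set.bex_max_element_with_property[of B pnest "\<lambda>V. W \<preceq> V"] fin W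
        asymp_on_subset[OF pnest_asym BS] transp_on_subset[OF pnest_trans BS] by blast
    have "\<not> pnest W' V" if V: "V \<in> B" for V
    proof
      assume "pnest W' V"
      moreover from this have "W \<preceq> V"
        using nest_trans W'(1,2) BS V W unfolding transp_on_def pnest_def by blast
      ultimately show False using W'(3) V by blast
    qed
    then show ?thesis using W'(1,2) unfolding M_def by blast
  qed
  define before where "before V W \<longleftrightarrow>
    transverse V W \<and> mdist (\<C> V) (b V) (rho_point W V) \<le> \<kappa>" for V W
  \<comment> \<open>As \<open>x\<close> is far from \<open>b\<close> in \<open>V\<close>, it is far
    from \<open>rho_point W V\<close>, and consistency for \<open>x\<close> applies. The next claim
    is a converse, from consistency of \<open>b\<close>.\<close>
  have before_rev: "mdist (\<C> W) (\<pi> W x) (rho_point V W) \<le> 3 * E"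
    if VW: "V \<in> B" "W \<in> \<SS>" "transverse V W"
      and near: "mdist (\<C> V) (b V) (rho_point W V) \<le> L - 3 * E" for V W
  proof -
    have V: "V \<in> \<SS>" using VW BS by auto
    have "3 * E < mdist (\<C> V) (\<pi> V x) (rho_point W V)"
      using split[OF VW(1) near] rho_set(4)[OF VW(2) V] transverse_sym[OF V VW(2,3)] by simp
    then show ?thesis using rho_point_transverse[OF V VW(2,3) x] by linarith
  qed
  have before_iff: "before V W"
    if VW: "V \<in> \<SS>" "W \<in> B" "transverse V W"
      and near: "mdist (\<C> W) (\<pi> W x) (rho_point V W) \<le> 3 * E" for V W
  proof -
    have W: "W \<in> \<SS>" using VW BS by auto
    have "\<kappa> < mdist (\<C> W) (b W) (rho_point V W)"
      using split'[OF VW(2) near] rho_set(4)[OF VW(1) W] VW(3) L \<kappa> E_ge_1 by simp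
    then show ?thesis using b_trans[OF VW(1) W VW(3)] VW(3) unfolding before_def by linarith
  qed
  have before_trans: "before U W" if M: "U \<in> M" "V \<in> M" "W \<in> M" and UV: "before U V" and VW: "before V W"
    for U V W
  proof -
    have inB: "U \<in> B" "V \<in> B" "W \<in> B" using M unfolding M_def by auto
    then have inS: "U \<in> \<SS>" "V \<in> \<SS>" "W \<in> \<SS>" using BS by auto
    have tr: "transverse U V" "transverse V W" "transverse V U" "transverse W V"
      using UV VW transverse_sym inS unfolding before_def by auto
    have near: "mdist (\<C> U) (b U) (rho_point V U) \<le> \<kappa>" "mdist (\<C> V) (b V) (rho_point W V) \<le> \<kappa>"
      using UV VW unfolding before_def by auto
    have xV: "mdist (\<C> V) (\<pi> V x) (rho_point U V) \<le> 3 * E"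
      using before_rev[OF inB(1) inS(2) tr(1)] near(1) L \<kappa> E_ge_1 by simp
    have rho_in: "rho_point U V \<in> mspace (\<C> V)" "rho_point W V \<in> mspace (\<C> V)"
      "rho_point V U \<in> mspace (\<C> U)"
      using rho_set(4) inS tr by auto
    \<comment> \<open>In \<open>V\<close>, the point \<open>x\<close> is near
      \<open>rho_point U V\<close> and \<open>b\<close> is near \<open>rho_point W V\<close>. Hence
      \<open>U\<close> and \<open>W\<close> are distinct and not orthogonal.\<close>
    have apart: "L - 3 * E - \<kappa> < mdist (\<C> V) (rho_point U V) (rho_point W V)"
      using split'[OF inB(2) xV rho_in(1)] near(2)
        tri[OF b_in[OF inS(2)] rho_in(2,1)] by (simp add: mdist_commute)
    have "U \<noteq> W" using apart L \<kappa> E_ge_1 rho_in by (auto simp: mdist_self)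
    have "\<not> orth U W"
      using rho_points_of_orthogonal_close[OF inS _ tr(1,4) b_in] apart L \<kappa> E_ge_1 by fastforce
    moreover have "\<not> U \<preceq> W" "\<not> W \<preceq> U"
      using M \<open>U \<noteq> W\<close> inB unfolding M_def pnest_def by auto
    ultimately have UW: "transverse U W" unfolding transverse_def comparable_def by blast
    have WU: "transverse W U" using transverse_sym[OF inS(1,3) UW] .
    have rUW: "rho_point W U \<in> mspace (\<C> U)" using rho_set(4) inS WU by auto
    \<comment> \<open>A point located at \<open>W\<close>. Its consistency in \<open>U\<close> and
      \<open>V\<close> brings \<open>rho_point W U\<close> close to \<open>rho_point V U\<close>,
      hence to \<open>b U\<close>.\<close>
    obtain z where z: "partially_realises b {W} z"
      using partial_realisation_point[of "{W}" b] b_in inS by (auto simp: pairwise_def)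
    have zX: "z \<in> mspace X" and zV: "mdist (\<C> V) (\<pi> V z) (rho_point W V) \<le> 3 * E"
      and zU: "mdist (\<C> U) (\<pi> U z) (rho_point W U) \<le> 3 * E"
      using z tr WU inS unfolding partially_realises_def by auto
    have "3 * E < mdist (\<C> V) (\<pi> V z) (rho_point U V)"
      using apart zV tri[OF rho_in(1) pi_in[OF inS(2) zX] rho_in(2)] L \<kappa> E_ge_1
      by (simp add: mdist_commute)
    then have "mdist (\<C> U) (\<pi> U z) (rho_point V U) \<le> 3 * E"
      using rho_point_transverse[OF inS(1,2) tr(1) zX] by linarith
    then have "mdist (\<C> U) (rho_point V U) (rho_point W U) \<le> 6 * E"
      using zU tri[OF rho_in(3) pi_in[OF inS(1) zX] rUW] by (simp add: mdist_commute)
    then have "mdist (\<C> U) (b U) (rho_point W U) \<le> L - 3 * E"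
      using near(1) tri[OF b_in[OF inS(1)] rho_in(3) rUW] L \<kappa> E_ge_1 by (simp add: mdist_commute)
    then have "mdist (\<C> W) (\<pi> W x) (rho_point U W) \<le> 3 * E"
      using before_rev[OF inB(1) inS(3) UW] by simp
    then show ?thesis using before_iff[OF inS(1) inB(3) UW] by simp
  qed
  have before_irrefl: "\<not> before V V" if "V \<in> \<SS>" for V
    using nest_refl that unfolding before_def transverse_def comparable_def reflp_on_def by blast
  have MB: "M \<subseteq> B" by (auto simp: M_def)
  have "transp_on M before" using before_trans unfolding transp_on_def by blast
  moreover have "asymp_on M before"
    using before_trans before_irrefl MB BS unfolding asymp_on_def by blast
  moreover have "finite M" "M \<noteq> {}" using fin MB above ne finite_subset by blast+
  \<comment> \<open>No member of \<open>M\<close> is crossed after this \<open>V\<close>.\<close>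
  ultimately obtain V where V: "V \<in> M" "\<And>W. W \<in> M \<Longrightarrow> W \<noteq> V \<Longrightarrow> \<not> before V W"
    using Finite_Set.bex_max_element[of M before] by blast
  have VB: "V \<in> B" and VS: "V \<in> \<SS>" using V(1) MB BS by auto
  have "mdist (\<C> W) (b W) (rho_point V W) \<le> L + \<kappa> + 3 * E"
    if W: "W \<in> D" and VW: "pnest V W \<or> transverse V W" for W
  proof -
    have WS: "W \<in> \<SS>" using W D by auto
    let ?r = "rho_point V W"
    have r: "?r \<in> mspace (\<C> W)" using rho_set(4)[OF VS WS VW] .
    show ?thesis
    proof (cases "W \<in> B")
      case False
      then have xb: "mdist (\<C> W) (\<pi> W x) (b W) \<le> L" using W B by auto
      have xr: "mdist (\<C> W) (b W) ?r \<le> L + mdist (\<C> W) (\<pi> W x) ?r"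
        using tri[OF b_in[OF WS] pi_in[OF WS x] r] xb by (simp add: mdist_commute)
      show ?thesis
      proof (cases "transverse V W")
        case True
        have rV: "rho_point W V \<in> mspace (\<C> V)"
          using rho_set(4)[OF WS VS] transverse_sym[OF VS WS True] by blast
        show ?thesis
        proof (cases "mdist (\<C> V) (b V) (rho_point W V) \<le> \<kappa>")
          case True
          then have "mdist (\<C> W) (\<pi> W x) ?r \<le> 3 * E"
            using before_rev[OF VB WS \<open>transverse V W\<close>] L \<kappa> E_ge_1 by simp
          then show ?thesis using xr \<kappa> E_ge_1 by simp
        next
          case False
          then show ?thesis using b_trans[OF VS WS True] L \<kappa> E_ge_1 by auto
        qed
      next
        case False
        then have nest: "pnest V W" using VW by blast
        show ?thesis
        proof (rule ccontr)
          \<comment> \<open>In \<open>W\<close>, \<open>x\<close> and \<open>b\<close> are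
            \<open>L\<close>-close, so both are far from \<open>rho_point V W\<close> and a geodesic
            between them avoids it. Bounded geodesic image then makes \<open>x\<close> and
            \<open>b\<close> close in \<open>V\<close>, against \<open>V \<in> B\<close>.\<close>
          assume "\<not> ?thesis"
          then have br: "L + \<kappa> + 3 * E < mdist (\<C> W) (b W) ?r" by simp
          then have "3 * E < mdist (\<C> W) (\<pi> W x) ?r" using xr \<kappa> E_ge_1 by simp
          then have 1: "mdist (\<C> V) (\<pi> V x) (\<rho>map W V (\<pi> W x)) \<le> 3 * E"
            using rho_point_nest[OF VS WS nest x] by linarith
          have 2: "mdist (\<C> V) (b V) (\<rho>map W V (b W)) \<le> \<kappa>"
            using b VS WS nest br L \<kappa> E_ge_1 unfolding consistent_tuple_def by fastforce
          have "3 * E < gromov_product (\<C> W) ?r (\<pi> W x) (b W)"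
            using br xr xb \<kappa> E_ge_1 unfolding gromov_product_def by (simp add: field_simps)
          then have 3: "mdist (\<C> V) (\<rho>map W V (\<pi> W x)) (\<rho>map W V (b W)) \<le> 3 * E"
            using rho_map_close[OF VS WS nest pi_in[OF WS x] b_in[OF WS]] by simp
          have "\<rho>map W V (\<pi> W x) \<in> mspace (\<C> V)" "\<rho>map W V (b W) \<in> mspace (\<C> V)"
            using rho_map[OF VS WS nest] pi_in[OF WS x] b_in[OF WS] by auto
          then have "mdist (\<C> V) (\<pi> V x) (b V) \<le> 6 * E + \<kappa>"
            using 1 2 3 tri[of "\<pi> V x" V "\<rho>map W V (b W)" "b V"]
              tri[of "\<pi> V x" V "\<rho>map W V (\<pi> W x)" "\<rho>map W V (b W)"] pi_in[OF VS x] b_in[OF VS]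
            by (simp add: mdist_commute)
          then show False using far[OF VB] L \<kappa> E_ge_1 by simp
        qed
      qed
    next
      case True
      then have VW': "transverse V W" using VW V(1) unfolding M_def by blast
      show ?thesis
      proof (rule ccontr)
        assume "\<not> ?thesis"
        then have "\<kappa> < mdist (\<C> W) (b W) ?r" using L \<kappa> E_ge_1 by simp
        then have near: "mdist (\<C> V) (b V) (rho_point W V) \<le> \<kappa>"
          using b_trans[OF VS WS VW'] by linarith
        \<comment> \<open>\<open>W\<close> need not be maximal. A member \<open>W'\<close> of
          \<open>M\<close> above it has nearly the same rho point in \<open>V\<close>, which yields
          \<open>before V W'\<close>, against the choice of \<open>V\<close>.\<close>
        obtain W' where W': "W' \<in> M" "W \<preceq> W'" using above[OF True] by blast
        have WB': "W' \<in> B" and WS': "W' \<in> \<SS>" using W'(1) MB BS by auto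
        have "\<not> V \<preceq> W'"
          using V(1) WB' W'(2) VW' unfolding M_def pnest_def transverse_def comparable_def by blast
        moreover have "\<not> W' \<preceq> V"
          using nest_trans W'(2) VW' WS WS' VS unfolding transp_on_def transverse_def comparable_def
          by blast
        moreover have "\<not> orth V W'"
          using orth_nest[OF WS WS' VS W'(2)] orth_sym VW' WS WS' VS
          unfolding transverse_def symp_on_def by blast
        ultimately have VWt: "transverse V W'" unfolding transverse_def comparable_def by blast
        have WVt: "transverse W' V" using transverse_sym[OF VS WS' VWt] .
        have "\<not> orth V W" using VW' unfolding transverse_def by blast
        then have "mdist (\<C> V) (rho_point W V) (rho_point W' V) \<le> 3 * E"
          using rho_point_nested_close(2)[OF WS WS' VS W'(2)] WVt by blast
        then have "mdist (\<C> V) (b V) (rho_point W' V) \<le> L - 3 * E"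
          using tri[of "b V" V "rho_point W V" "rho_point W' V"] near b_in[OF VS]
            rho_set(4)[OF WS VS] rho_set(4)[OF WS' VS] transverse_sym[OF VS WS VW'] WVt L \<kappa> E_ge_1
          by (simp add: mdist_commute)
        then have "before V W'"
          using before_iff[OF VS WB' VWt] before_rev[OF VB WS' VWt] by blast
        then show False using V(2)[OF W'(1)] before_irrefl[OF VS] by blast
      qed
    qed
  qed
  then show ?thesis using VB by blast
qed

section \<open>Well-foundedness of nesting and finiteness of the relevant domains\<close>

lemma no_infinite_comparable_sequence:
  fixes f :: "nat \<Rightarrow> 'u"
  assumes "\<And>i. f i \<in> \<SS>" "\<And>i j. i < j \<Longrightarrow> comparable (f i) (f j) \<and> f i \<noteq> f j"
  shows False
proof -
  have "inj f" using assms(2) by (metis injI linorder_neqE_nat)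
  moreover have "pairwise comparable (range f)"
    using assms(2) unfolding pairwise_def comparable_def by (metis linorder_neqE_nat rangeE)
  then have "finite (range f)" using finite_complexity assms(1) by blast
  ultimately show False using range_inj_infinite by blast
qed

text \<open>A strictly monotone sequence would have an infinite range of pairwise comparable
  domains. The first order serves for induction, its converse finds maximal domains.\<close>

lemma wf_pnest: "wf {(U, V). U \<in> \<SS> \<and> V \<in> \<SS> \<and> pnest U V}" (is "wf ?R")
  and wf_pnest_converse: "wf {(V, U). U \<in> \<SS> \<and> V \<in> \<SS> \<and> pnest U V}" (is "wf ?R'")
proof -
  have trans: "trans ?R" "trans ?R'"
    using nest_trans nest_antisym
    unfolding trans_def transp_on_def antisymp_on_def pnest_def by blast+
  have chain: "(f j, f i) \<in> S" if "trans S" "\<forall>i. (f (Suc i), f i) \<in> S" "i < j"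
    for f :: "nat \<Rightarrow> 'u" and S i j
    using that(3) by (induction rule: less_Suc_induct) (use that(1,2) in \<open>auto dest: transD\<close>)
  show "wf ?R"
    unfolding wf_iff_no_infinite_down_chain
  proof
    assume "\<exists>f. \<forall>i. (f (Suc i), f i) \<in> ?R"
    then obtain f where f: "\<forall>i. (f (Suc i), f i) \<in> ?R" by blast
    show False
    proof (rule no_infinite_comparable_sequence)
      show "f i \<in> \<SS>" for i using f by simp
      show "comparable (f i) (f j) \<and> f i \<noteq> f j" if "i < j" for i j
        using chain[OF trans(1) f that] by (auto simp: comparable_def pnest_def)
    qed
  qed
  show "wf ?R'"
    unfolding wf_iff_no_infinite_down_chain
  proof
    assume "\<exists>f. \<forall>i. (f (Suc i), f i) \<in> ?R'"
    then obtain f where f: "\<forall>i. (f (Suc i), f i) \<in> ?R'" by blast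
    show False
    proof (rule no_infinite_comparable_sequence)
      show "f i \<in> \<SS>" for i using f by simp
      show "comparable (f i) (f j) \<and> f i \<noteq> f j" if "i < j" for i j
        using chain[OF trans(2) f that] by (auto simp: comparable_def pnest_def)
    qed
  qed
qed

text \<open>The axiom gives a unique maximal domain. Ascending chains are finite, so each domain
  lies below a maximal one, which must be this one.\<close>

lemma top_domain:
  assumes "\<SS> \<noteq> {}"
  shows "\<exists>M\<in>\<SS>. \<forall>U\<in>\<SS>. U \<preceq> M"
proof -
  obtain M where M: "M \<in> \<SS>" "\<And>N. N \<in> \<SS> \<Longrightarrow> \<forall>V\<in>\<SS>. \<not> pnest N V \<Longrightarrow> N = M"
    using unique_maximal[OF assms] by blast
  have "U \<preceq> M" if U: "U \<in> \<SS>" for U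
  proof -
    have "U \<in> {V \<in> \<SS>. U \<preceq> V}" using U nest_refl by (auto simp: reflp_on_def)
    from wf_pnest_converse[unfolded wf_eq_minimal, rule_format, OF this]
    obtain N where N: "N \<in> {V \<in> \<SS>. U \<preceq> V}"
      "\<forall>V. (V, N) \<in> {(V, U). U \<in> \<SS> \<and> V \<in> \<SS> \<and> pnest U V} \<longrightarrow> V \<notin> {V \<in> \<SS>. U \<preceq> V}"
      by (elim bexE)
    have "\<not> pnest N V" if V: "V \<in> \<SS>" for V
    proof
      assume NV: "pnest N V"
      then have "U \<preceq> V"
        using N(1) U V nest_trans unfolding transp_on_def pnest_def by blast
      then show False using N(2)[rule_format, of V] N(1) NV V by simp
    qed
    then show ?thesis using M(2)[of N] N(1) by blast
  qed
  then show ?thesis using M(1) by blast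
qed

text \<open>Induction on a domain \<open>T\<close>: by large links, every relevant domain properly
  nested in \<open>T\<close> is nested in one of finitely many smaller ones.\<close>

lemma finite_relevant_domains:
  assumes x: "x \<in> mspace X" "x' \<in> mspace X"
  shows "finite {W \<in> \<SS>. E \<le> mdist (\<C> W) (\<pi> W x) (\<pi> W x')}"
proof (cases "\<SS> = {}")
  case False
  let ?far = "\<lambda>T. {W \<in> \<SS>. W \<preceq> T \<and> E \<le> mdist (\<C> W) (\<pi> W x) (\<pi> W x')}"
  have "T \<in> \<SS> \<Longrightarrow> finite (?far T)" for T
  proof (induction T rule: wf_induct[OF wf_pnest])
    case (1 T)
    then obtain \<T> where \<T>: "\<T> \<subseteq> {V \<in> \<SS>. pnest V T}" "finite \<T>"
      "\<And>W. W \<in> \<SS> \<Longrightarrow> pnest W T \<Longrightarrow>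
         (\<exists>V\<in>\<T>. W \<preceq> V) \<or> mdist (\<C> W) (\<pi> W x) (\<pi> W x') < E"
      using large_links[OF _ x refl, of T] by blast
    have "?far T \<subseteq> insert T (\<Union>V\<in>\<T>. ?far V)"
      using \<T>(3) unfolding pnest_def by force
    moreover have "finite (?far V)" if "V \<in> \<T>" for V using 1 \<T>(1) that by blast
    ultimately show ?case using \<T>(2) by (meson finite_UN_I finite_insert finite_subset)
  qed
  moreover obtain M where M: "M \<in> \<SS>" "\<And>U. U \<in> \<SS> \<Longrightarrow> U \<preceq> M" using top_domain[OF False] by blast
  moreover have "{W \<in> \<SS>. E \<le> mdist (\<C> W) (\<pi> W x) (\<pi> W x')} = ?far M" using M(2) by blast
  ultimately show ?thesis by simp
qed simp

definition nested_orth :: "'u \<Rightarrow> 'u set \<Rightarrow> 'u set" where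
  "nested_orth T \<A> = {W \<in> \<SS>. W \<preceq> T \<and> (\<forall>V\<in>\<A>. orth W V)}"

text \<open>
  Realising \<open>b\<close> on the domains nested in \<open>T\<close> and orthogonal to \<open>\<A>\<close>. If some \<open>x\<close> is not close to
  \<open>b\<close> there, choose \<open>V\<close> as in \<open>last_discrepancy\<close>, first realise \<open>b\<close> on \<open>V\<close> by a family \<open>\<U>\<close>, and
  then on the domains orthogonal to \<open>\<U>\<close>, which a container puts inside some \<open>T' \<prec> T\<close>. All other
  domains \<open>W\<close> see \<open>b\<close> at \<open>\<rho>\<^sup>V\<^sub>W\<close>, where partial realisation puts the point.
\<close>

lemma orthogonal_realising_family:
  assumes b: "consistent_tuple \<kappa> b" and \<kappa>: "3 * E \<le> \<kappa>" and L: "2 * \<kappa> + 12 * E < L"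
    and fin: "\<And>x. x \<in> mspace X \<Longrightarrow> finite {W \<in> \<SS>. L < mdist (\<C> W) (\<pi> W x) (b W)}"
    and "T \<in> \<SS>" "\<A> \<subseteq> \<SS>"
  shows "\<exists>\<U>\<subseteq>nested_orth T \<A>. pairwise orth \<U> \<and> (\<A> = {} \<longrightarrow> \<U> \<noteq> {}) \<and>
    (\<forall>y. partially_realises b \<U> y \<longrightarrow>
      (\<forall>W\<in>nested_orth T \<A>. mdist (\<C> W) (\<pi> W y) (b W) \<le> L + \<kappa> + 9 * E))"
  using assms(5,6)
proof (induction T arbitrary: \<A> rule: wf_induct_rule[OF wf_pnest])
  case (1 T)
  note IH = 1(1) and T = 1(2) and \<A> = 1(3)
  let ?D = "nested_orth T \<A>"
  have b_in: "b U \<in> mspace (\<C> U)" if "U \<in> \<SS>" for U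
    using b that unfolding consistent_tuple_def by blast
  have D: "?D \<subseteq> \<SS>" "\<And>W. W \<in> ?D \<Longrightarrow> W \<preceq> T" unfolding nested_orth_def by auto
  have TD: "T \<in> ?D" if "\<A> = {}" using that T nest_refl by (auto simp: nested_orth_def reflp_on_def)
  show ?case
  proof (cases "\<forall>y\<in>mspace X. (T \<in> ?D \<longrightarrow> mdist (\<C> T) (\<pi> T y) (b T) \<le> E) \<longrightarrow>
      (\<forall>W\<in>?D. mdist (\<C> W) (\<pi> W y) (b W) \<le> L)")
    case True
    \<comment> \<open>Empty if \<open>T\<close> is not orthogonal to \<open>\<A>\<close>; the case
      assumption then covers every point.\<close>
    let ?U = "{T} \<inter> ?D"
    have "mdist (\<C> W) (\<pi> W y) (b W) \<le> L + \<kappa> + 9 * E"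
      if "partially_realises b ?U y" "W \<in> ?D" for y W
      using True that \<kappa> E_ge_1 unfolding partially_realises_def by fastforce
    moreover have "pairwise orth ?U" by (auto simp: pairwise_def)
    ultimately show ?thesis using TD by (intro exI[of _ ?U]) auto
  next
    case False
    then obtain x where x: "x \<in> mspace X" "T \<in> ?D \<Longrightarrow> mdist (\<C> T) (\<pi> T x) (b T) \<le> E"
      and ne: "{W \<in> ?D. L < mdist (\<C> W) (\<pi> W x) (b W)} \<noteq> {}"
      by (auto simp: not_le)
    have "finite {W \<in> ?D. L < mdist (\<C> W) (\<pi> W x) (b W)}"
      by (rule finite_subset[OF _ fin[OF x(1)]]) (use D in auto)
    then obtain V where V: "V \<in> ?D" "L < mdist (\<C> V) (\<pi> V x) (b V)"
      and last: "\<And>W. W \<in> ?D \<Longrightarrow> pnest V W \<or> transverse V W \<Longrightarrow>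
        mdist (\<C> W) (b W) (rho_point V W) \<le> L + \<kappa> + 3 * E"
      using last_discrepancy[OF b \<kappa> L x(1) D(1) refl _ ne] by blast
    have VS: "V \<in> \<SS>" using V(1) D(1) by blast
    have "V \<noteq> T" using V x(2) L \<kappa> E_ge_1 by auto
    then have VT: "pnest V T" using D(2)[OF V(1)] by (simp add: pnest_def)
    \<comment> \<open>Taking \<open>\<A>\<close> empty makes \<open>\<U>\<^sub>1\<close> nonempty; a
      member of it provides the container below.\<close>
    obtain \<U>\<^sub>1 where U1: "\<U>\<^sub>1 \<subseteq> nested_orth V {}" "pairwise orth \<U>\<^sub>1" "\<U>\<^sub>1 \<noteq> {}"
      and U1_real: "\<And>y W. partially_realises b \<U>\<^sub>1 y \<Longrightarrow> W \<in> nested_orth V {} \<Longrightarrow>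
        mdist (\<C> W) (\<pi> W y) (b W) \<le> L + \<kappa> + 9 * E"
      using IH[of V "{}"] VS T VT by blast
    have U1V: "U \<in> \<SS>" "U \<preceq> V" if "U \<in> \<U>\<^sub>1" for U
      using U1(1) that unfolding nested_orth_def by auto
    have U1T: "U \<preceq> T" if "U \<in> \<U>\<^sub>1" for U
      using U1V[OF that] VT VS T nest_trans unfolding pnest_def transp_on_def by blast
    have U1D: "\<U>\<^sub>1 \<subseteq> ?D"
    proof
      fix U assume U: "U \<in> \<U>\<^sub>1"
      have "orth U A" if "A \<in> \<A>" for A
        using orth_nest[OF U1V(1)[OF U] VS _ U1V(2)[OF U]] V(1) \<A> that
        unfolding nested_orth_def by blast
      then show "U \<in> ?D" using U1V(1)[OF U] U1T[OF U] unfolding nested_orth_def by blast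
    qed
    let ?D' = "nested_orth T (\<A> \<union> \<U>\<^sub>1)"
    have D': "\<A> \<union> \<U>\<^sub>1 \<subseteq> \<SS>" using \<A> U1V by auto
    obtain \<U>\<^sub>2 where U2: "\<U>\<^sub>2 \<subseteq> ?D'" "pairwise orth \<U>\<^sub>2"
      and U2_real: "\<And>y W. partially_realises b \<U>\<^sub>2 y \<Longrightarrow> W \<in> ?D' \<Longrightarrow>
        mdist (\<C> W) (\<pi> W y) (b W) \<le> L + \<kappa> + 9 * E"
    proof (cases "?D' = {}")
      case True
      then show ?thesis using that[of "{}"] by simp
    next
      case False
      obtain U where U: "U \<in> \<U>\<^sub>1" using U1(3) by blast
      have "\<exists>W\<in>\<SS>. W \<preceq> T \<and> orth W U"
        using False U unfolding nested_orth_def by blast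
      then obtain T' where T': "T' \<in> \<SS>" "pnest T' T"
        "\<And>W. W \<in> \<SS> \<Longrightarrow> W \<preceq> T \<Longrightarrow> orth W U \<Longrightarrow> W \<preceq> T'"
        using orth_container[OF T U1V(1)[OF U] U1T[OF U]] by blast
      \<comment> \<open>The smaller domain \<open>T'\<close> describes the same set
        \<open>?D'\<close>, so the induction hypothesis applies.\<close>
      have eq: "?D' = nested_orth T' (\<A> \<union> \<U>\<^sub>1)"
        using T' U T nest_trans unfolding nested_orth_def pnest_def transp_on_def by blast
      have "(T', T) \<in> {(U, V). U \<in> \<SS> \<and> V \<in> \<SS> \<and> pnest U V}"
        using T' T by simp
      from IH[OF this T'(1) D', folded eq] obtain \<U> where "\<U> \<subseteq> ?D'" "pairwise orth \<U>"
        "\<forall>y. partially_realises b \<U> y \<longrightarrow>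
          (\<forall>W\<in>?D'. mdist (\<C> W) (\<pi> W y) (b W) \<le> L + \<kappa> + 9 * E)"
        by (elim exE conjE)
      then show ?thesis using that[of \<U>] by simp
    qed
    have U2': "U \<in> \<SS>" "U \<in> ?D" "\<And>V. V \<in> \<U>\<^sub>1 \<Longrightarrow> orth U V" if "U \<in> \<U>\<^sub>2" for U
      using U2(1) that unfolding nested_orth_def by auto
    have "pairwise orth (\<U>\<^sub>1 \<union> \<U>\<^sub>2)"
      using U1(2) U2(2) U2' U1V(1) orth_sym unfolding pairwise_def symp_on_def by blast
    moreover have "\<U>\<^sub>1 \<union> \<U>\<^sub>2 \<subseteq> ?D" using U1D U2'(2) by blast
    moreover have "mdist (\<C> W) (\<pi> W y) (b W) \<le> L + \<kappa> + 9 * E"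
      if y: "partially_realises b (\<U>\<^sub>1 \<union> \<U>\<^sub>2) y" and W: "W \<in> ?D" for y W
    proof -
      have y12: "partially_realises b \<U>\<^sub>1 y" "partially_realises b \<U>\<^sub>2 y"
        using y unfolding partially_realises_def by auto
      have WS: "W \<in> \<SS>" using W D(1) by blast
      consider "W \<preceq> V" | "W \<in> ?D'" | U where "\<not> W \<preceq> V" "U \<in> \<U>\<^sub>1" "\<not> orth W U"
        using W unfolding nested_orth_def by blast
      then show ?thesis
      proof cases
        case 1
        then show ?thesis using U1_real[OF y12(1)] WS by (simp add: nested_orth_def)
      next
        case 2
        then show ?thesis using U2_real[OF y12(2)] by blast
      next
        \<comment> \<open>In \<open>W\<close> the rho points of \<open>U\<close> and
          \<open>V\<close> are close; \<open>y\<close> is near the former by partial realisation and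
          \<open>b W\<close> near the latter by \<open>last\<close>. The errors are
          \<open>3 * E\<close>, \<open>3 * E\<close> and
          \<open>L + \<kappa> + 3 * E\<close>.\<close>
        case (3 U)
        note U = U1V[OF 3(2)]
        have "\<not> orth V W"
          using orth_nest[OF U(1) VS WS U(2)] orth_sym 3(3) U(1) WS unfolding symp_on_def by blast
        then have VW: "pnest V W \<or> transverse V W"
          using 3(1) nest_refl VS unfolding pnest_def transverse_def comparable_def reflp_on_def
          by blast
        note UW = rho_point_nested_close[OF U(1) VS WS U(2) VW 3(3)]
        have yW: "\<pi> W y \<in> mspace (\<C> W)" "mdist (\<C> W) (\<pi> W y) (rho_point U W) \<le> 3 * E"
          using y12(1) 3(2) UW(1) WS pi_in unfolding partially_realises_def by blast+
        have r: "rho_point U W \<in> mspace (\<C> W)" "rho_point V W \<in> mspace (\<C> W)"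
          using rho_set(4) UW(1) VW U VS WS by blast+
        have "mdist (\<C> W) (\<pi> W y) (rho_point V W) \<le> 6 * E"
          using mdist_triangle[OF yW(1) r] yW(2) UW(2) by simp
        then show ?thesis
          using mdist_triangle[OF yW(1) r(2) b_in[OF WS]] last[OF W VW]
          by (simp add: mdist_commute)
      qed
    qed
    ultimately show ?thesis using U1(3) by (intro exI[of _ "\<U>\<^sub>1 \<union> \<U>\<^sub>2"]) auto
  qed
qed

theorem realisation:
  assumes b: "consistent_tuple \<kappa> b" and \<kappa>: "3 * E \<le> \<kappa>" and L: "2 * \<kappa> + 12 * E < L"
    and fin: "\<And>x. x \<in> mspace X \<Longrightarrow> finite {W \<in> \<SS>. L < mdist (\<C> W) (\<pi> W x) (b W)}"
    and "\<SS> \<noteq> {}"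
  shows "\<exists>y\<in>mspace X. \<forall>W\<in>\<SS>. mdist (\<C> W) (\<pi> W y) (b W) \<le> L + \<kappa> + 9 * E"
proof -
  obtain M where M: "M \<in> \<SS>" "\<And>U. U \<in> \<SS> \<Longrightarrow> U \<preceq> M" using top_domain[OF assms(5)] by blast
  then have all: "nested_orth M {} = \<SS>" by (auto simp: nested_orth_def)
  obtain \<U> where "\<U> \<subseteq> \<SS>" "pairwise orth \<U>"
    and U: "\<And>y W. partially_realises b \<U> y \<Longrightarrow> W \<in> \<SS> \<Longrightarrow>
      mdist (\<C> W) (\<pi> W y) (b W) \<le> L + \<kappa> + 9 * E"
    using orthogonal_realising_family[OF b \<kappa> L fin M(1), of "{}"] unfolding all by blast
  then obtain y where "partially_realises b \<U> y"
    using partial_realisation_point[of \<U> b] b unfolding consistent_tuple_def by blast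
  then show ?thesis using U unfolding partially_realises_def by blast
qed

section \<open>Medians of connected finite sets\<close>

lemma four_point: "U \<in> \<SS> \<Longrightarrow> four_point_hyperbolic (\<C> U) (4 * E)"
  using hyperbolic_space_four_point geodesic hyperbolic E_ge_1 by blast

context
  fixes F
  assumes F: "finite F" "F \<noteq> {}" "F \<subseteq> mspace X"
    and connected: "\<And>P. P \<subseteq> F \<Longrightarrow> P \<noteq> {} \<Longrightarrow> P \<noteq> F \<Longrightarrow> \<exists>x\<in>P. \<exists>y\<in>F - P. mdist X x y \<le> 1"
begin

lemma pi_F: "U \<in> \<SS> \<Longrightarrow> \<pi> U ` F \<subseteq> mspace (\<C> U)"
  using F(3) pi_in by blast

lemma median_unique:
  assumes U: "U \<in> \<SS>" and "median_center (\<C> U) (\<pi> U) F (22 * E) b"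
    "median_center (\<C> U) (\<pi> U) F (22 * E) b'"
  shows "mdist (\<C> U) b b' \<le> 54 * E"
proof -
  have "\<exists>x\<in>P. \<exists>y\<in>F - P. mdist (\<C> U) (\<pi> U x) (\<pi> U y) \<le> 2 * E"
    if P: "P \<subseteq> F" "P \<noteq> {}" "P \<noteq> F" for P
  proof -
    obtain x y where xy: "x \<in> P" "y \<in> F - P" "mdist X x y \<le> 1" using connected[OF P] by blast
    then have "mdist (\<C> U) (\<pi> U x) (\<pi> U y) \<le> E * mdist X x y + E"
      using proj_coarsely_lipschitz[OF U] P(1) F(3) unfolding coarsely_lipschitz_def by blast
    also have "\<dots> \<le> E * 1 + E" using xy(3) E_ge_1 by (intro add_mono mult_left_mono) auto
    finally show ?thesis using xy(1,2) by auto
  qed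
  then show ?thesis
    \<comment> \<open>The bound is \<open>2 * (22 * E) + 2 * (4 * E) + 2 * E\<close>.\<close>
    using median_center_unique[OF four_point[OF U] assms(2,3) F(1,2) pi_F[OF U], of "2 * E"] E_ge_1
    by simp
qed

context
  fixes b
  assumes b: "\<And>U. U \<in> \<SS> \<Longrightarrow> median_center (\<C> U) (\<pi> U) F (22 * E) (b U)"
begin

lemma median_in: "U \<in> \<SS> \<Longrightarrow> b U \<in> mspace (\<C> U)"
  using b by (simp add: median_center_def)

text \<open>If half of \<open>F\<close> projects near \<open>r\<close>, then \<open>r\<close> is
  itself a median, and medians are coarsely unique.\<close>

lemma median_near:
  assumes U: "U \<in> \<SS>" and "r \<in> mspace (\<C> U)" "P \<subseteq> F" "card F \<le> 2 * card P"
    and "\<And>x. x \<in> P \<Longrightarrow> mdist (\<C> U) (\<pi> U x) r \<le> 22 * E"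
  shows "mdist (\<C> U) (b U) r \<le> 54 * E"
  using median_unique[OF U b[OF U] median_center_of_half[OF F(1) assms(3,4,2) pi_F[OF U] assms(5)]] .

lemma median_half:
  assumes "U \<in> \<SS>" "q \<in> mspace (\<C> U)"
  shows "\<exists>P\<subseteq>F. card F \<le> 2 * card P \<and>
    (\<forall>x\<in>P. gromov_product (\<C> U) (b U) (\<pi> U x) q < 26 * E + 1)"
  \<comment> \<open>Here \<open>K + \<delta>\<close> is \<open>22 * E + 4 * E\<close>; the added 1
    makes the cut-off strictly larger.\<close>
  using median_center_half[OF four_point b F(1) pi_F, of U q "26 * E + 1"] assms by auto

lemma medians_consistent: "consistent_tuple (57 * E) b"
  unfolding consistent_tuple_def
proof (intro conjI ballI impI)
  show "b U \<in> mspace (\<C> U)" if "U \<in> \<SS>" for U using median_in[OF that] .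
next
  fix U V assume UV: "U \<in> \<SS>" "V \<in> \<SS>" "transverse U V"
  have r: "rho_point V U \<in> mspace (\<C> U)" "rho_point U V \<in> mspace (\<C> V)"
    using rho_set(4) UV transverse_sym[OF UV] by auto
  obtain P where P: "P \<subseteq> F" "card F \<le> 2 * card P"
    "\<And>x. x \<in> P \<Longrightarrow> gromov_product (\<C> U) (b U) (\<pi> U x) (rho_point V U) < 26 * E + 1"
    using median_half[OF UV(1) r(1)] by blast
  show "mdist (\<C> U) (b U) (rho_point V U) \<le> 57 * E \<or> mdist (\<C> V) (b V) (rho_point U V) \<le> 57 * E"
  proof (subst disj_imp, rule impI)
    assume far: "\<not> mdist (\<C> U) (b U) (rho_point V U) \<le> 57 * E"
    have "mdist (\<C> V) (\<pi> V x) (rho_point U V) \<le> 22 * E" if x: "x \<in> P" for x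
    proof -
      have "x \<in> mspace X" using x P(1) F(3) by auto
      \<comment> \<open>This decides the constant:
        \<open>57 * E - 2 * (26 * E + 1) \<ge> 3 * E\<close> because
        \<open>E \<ge> 1\<close>.\<close>
      moreover have "3 * E < mdist (\<C> U) (\<pi> U x) (rho_point V U)"
        using P(3)[OF x] far E_ge_1
          mdist_le_gromov_product[of "\<C> U" "b U" "rho_point V U" "\<pi> U x"] by linarith
      ultimately show ?thesis using rho_point_transverse[OF UV] E_ge_1 by fastforce
    qed
    then have "mdist (\<C> V) (b V) (rho_point U V) \<le> 54 * E"
      using median_near[OF UV(2) r(2) P(1,2)] by blast
    then show "mdist (\<C> V) (b V) (rho_point U V) \<le> 57 * E" using E_ge_1 by simp
  qed
next
  fix U V assume UV: "U \<in> \<SS>" "V \<in> \<SS>" "pnest U V"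
  have r: "rho_point U V \<in> mspace (\<C> V)"
    using rho_set(4) UV by auto
  have m: "\<rho>map V U (b V) \<in> mspace (\<C> U)" using rho_map[OF UV] median_in[OF UV(2)] by auto
  obtain P where P: "P \<subseteq> F" "card F \<le> 2 * card P"
    "\<And>x. x \<in> P \<Longrightarrow> gromov_product (\<C> V) (b V) (\<pi> V x) (rho_point U V) < 26 * E + 1"
    using median_half[OF UV(2) r] by blast
  show "mdist (\<C> V) (b V) (rho_point U V) \<le> 57 * E \<or>
    mdist (\<C> U) (b U) (\<rho>map V U (b V)) \<le> 57 * E"
  proof (subst disj_imp, rule impI)
    assume far: "\<not> mdist (\<C> V) (b V) (rho_point U V) \<le> 57 * E"
    have "mdist (\<C> U) (\<pi> U x) (\<rho>map V U (b V)) \<le> 22 * E" if x: "x \<in> P" for x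
    proof -
      have xX: "x \<in> mspace X" using x P(1) F(3) by auto
      \<comment> \<open>The products at \<open>b V\<close> and at \<open>rho_point U V\<close> add
        up to the distance between these two points.\<close>
      have g: "3 * E < gromov_product (\<C> V) (rho_point U V) (\<pi> V x) (b V)"
        using P(3)[OF x] far E_ge_1 unfolding gromov_product_def by (simp add: mdist_commute field_simps)
      then have "3 * E < mdist (\<C> V) (\<pi> V x) (rho_point U V)"
        using gromov_product_le_mdist[OF r pi_in[OF UV(2) xX] median_in[OF UV(2)]] by simp
      then have "mdist (\<C> U) (\<pi> U x) (\<rho>map V U (\<pi> V x)) \<le> 3 * E"
        using rho_point_nest[OF UV xX] by linarith
      moreover have "mdist (\<C> U) (\<rho>map V U (\<pi> V x)) (\<rho>map V U (b V)) \<le> 3 * E"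
        using rho_map_close[OF UV pi_in[OF UV(2) xX] median_in[OF UV(2)] g] .
      moreover have "\<rho>map V U (\<pi> V x) \<in> mspace (\<C> U)"
        using rho_map[OF UV] pi_in[OF UV(2) xX] by auto
      ultimately show ?thesis
        using mdist_triangle[OF pi_in[OF UV(1) xX] _ m] E_ge_1 by fastforce
    qed
    then have "mdist (\<C> U) (b U) (\<rho>map V U (b V)) \<le> 54 * E"
      using median_near[OF UV(1) m P(1,2)] by blast
    then show "mdist (\<C> U) (b U) (\<rho>map V U (b V)) \<le> 57 * E" using E_ge_1 by simp
  qed
qed

text \<open>For half of the \<open>z\<close> in \<open>F\<close>, the median lies coarsely between
  \<open>z\<close> and \<open>x\<close>; where it is far from \<open>x\<close>, so is
  \<open>z\<close>. The bound \<open>130 * E\<close> exceeds the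
  \<open>2 * (57 * E) + 12 * E\<close> that \<open>realisation\<close> asks for.\<close>

lemma finite_far_medians:
  assumes x: "x \<in> mspace X"
  shows "finite {W \<in> \<SS>. 130 * E < mdist (\<C> W) (\<pi> W x) (b W)}"
proof (rule finite_subset)
  show "{W \<in> \<SS>. 130 * E < mdist (\<C> W) (\<pi> W x) (b W)} \<subseteq>
    (\<Union>z\<in>F. {W \<in> \<SS>. E \<le> mdist (\<C> W) (\<pi> W x) (\<pi> W z)})"
  proof safe
    fix W assume W: "W \<in> \<SS>" "130 * E < mdist (\<C> W) (\<pi> W x) (b W)"
    obtain P where P: "P \<subseteq> F" "card F \<le> 2 * card P"
      "\<And>z. z \<in> P \<Longrightarrow> gromov_product (\<C> W) (b W) (\<pi> W z) (\<pi> W x) < 26 * E + 1"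
      using median_half[OF W(1) pi_in[OF W(1) x]] by blast
    have "P \<noteq> {}" using P(2) F(1,2) by auto
    then obtain z where z: "z \<in> P" by blast
    have "E \<le> mdist (\<C> W) (\<pi> W x) (\<pi> W z)"
      using P(3)[OF z] W(2) E_ge_1 mdist_le_gromov_product[of "\<C> W" "b W" "\<pi> W x" "\<pi> W z"]
      unfolding mdist_commute[of "\<C> W" "\<pi> W x"] by linarith
    then show "W \<in> (\<Union>z\<in>F. {W \<in> \<SS>. E \<le> mdist (\<C> W) (\<pi> W x) (\<pi> W z)})"
      using z P(1) W(1) by blast
  qed
  show "finite (\<Union>z\<in>F. {W \<in> \<SS>. E \<le> mdist (\<C> W) (\<pi> W x) (\<pi> W z)})"
    using F finite_relevant_domains[OF x] by blast
qed

end

text \<open>The bound is for every median \<open>c\<close>, because a group element carries a chosen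
  median only to some median. It covers the \<open>196 * E\<close> of realisation and the
  \<open>54 * E\<close> of uniqueness.\<close>

theorem median_point:
  assumes "\<SS> \<noteq> {}"
  shows "\<exists>y\<in>mspace X. \<forall>W\<in>\<SS>. \<forall>c. median_center (\<C> W) (\<pi> W) F (22 * E) c \<longrightarrow>
    mdist (\<C> W) (\<pi> W y) c \<le> 250 * E"
proof -
  have "\<exists>c. median_center (\<C> W) (\<pi> W) F (22 * E) c" if W: "W \<in> \<SS>" for W
    using median_center_exists[OF geodesic[OF W] hyperbolic[OF W] E_ge_1 F(1,2) pi_F[OF W]] .
  then obtain b where b: "\<And>W. W \<in> \<SS> \<Longrightarrow> median_center (\<C> W) (\<pi> W) F (22 * E) (b W)"
    by metis
  obtain y where y: "y \<in> mspace X"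
    "\<And>W. W \<in> \<SS> \<Longrightarrow> mdist (\<C> W) (\<pi> W y) (b W) \<le> 130 * E + 57 * E + 9 * E"
    using realisation[OF medians_consistent[OF b] _ _ finite_far_medians[OF b] assms] E_ge_1 by auto
  have "mdist (\<C> W) (\<pi> W y) c \<le> 250 * E"
    if W: "W \<in> \<SS>" and c: "median_center (\<C> W) (\<pi> W) F (22 * E) c" for W c
    using y(2)[OF W] median_unique[OF W b[OF W] c] median_in[OF b W] pi_in[OF W y(1)] c
      mdist_triangle[of "\<pi> W y" "\<C> W" "b W" c] by (simp add: median_center_def)
  then show ?thesis using y(1) by blast
qed

end

end

section \<open>Finite subgroups\<close>

text \<open>Majorities pull back along \<open>\<sigma>\<close> to majorities. There are two spaces
  because a group element may move the domain.\<close>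

lemma median_center_isometry:
  assumes \<phi>: "isometry_onto m n \<phi>" and b: "median_center m f F K b" and F: "f ` F \<subseteq> mspace m"
    and \<sigma>: "bij_betw \<sigma> F F" and g: "\<And>x. x \<in> F \<Longrightarrow> g (\<sigma> x) = \<phi> (f x)"
  shows "median_center n g F K (\<phi> b)"
  unfolding median_center_def
proof (intro conjI allI impI)
  have bm: "b \<in> mspace m" using b by (simp add: median_center_def)
  then show "\<phi> b \<in> mspace n" using \<phi> unfolding isometry_onto_def by blast
  fix F' assume F': "F' \<subseteq> F" "card F < 2 * card F'"
  define P where "P = {x \<in> F. \<sigma> x \<in> F'}"
  have P: "P \<subseteq> F" by (auto simp: P_def)
  have "\<sigma> ` F = F" "inj_on \<sigma> F" using \<sigma> by (auto simp: bij_betw_def)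
  then have "\<sigma> ` P = F'" "inj_on \<sigma> P"
    using F'(1) inj_on_subset[OF _ P] by (auto simp: P_def image_iff subset_iff)
  then have "card F < 2 * card P" using F'(2) card_image by metis
  then obtain x y where xy: "x \<in> P" "y \<in> P" "gromov_product m b (f x) (f y) \<le> K"
    using b P unfolding median_center_def by blast
  have "f x \<in> mspace m" "f y \<in> mspace m" "g (\<sigma> x) = \<phi> (f x)" "g (\<sigma> y) = \<phi> (f y)"
    using xy P F g by auto
  then have "gromov_product n (\<phi> b) (g (\<sigma> x)) (g (\<sigma> y)) \<le> K"
    using \<phi> bm xy(3) unfolding gromov_product_def isometry_onto_def by simp
  then show "\<exists>x\<in>F'. \<exists>y\<in>F'. gromov_product n (\<phi> b) (g x) (g y) \<le> K"
    using xy unfolding P_def by blast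
qed

section \<open>Translations, balls, neighbourhoods and conjugates in Cayley graphs\<close>

context group
begin

lemma cayley_edges_translate:
  assumes "A \<subseteq> carrier G" "g \<in> carrier G" "(x, y) \<in> cayley_edges G A"
  shows "(g \<otimes> x, g \<otimes> y) \<in> cayley_edges G A"
  using assms unfolding cayley_edges_def by (auto simp: m_assoc[symmetric]) (metis m_assoc subsetD)+

lemma cayley_relpow_translate:
  assumes "A \<subseteq> carrier G" "g \<in> carrier G" "(x, y) \<in> cayley_edges G A ^^ n"
  shows "(g \<otimes> x, g \<otimes> y) \<in> cayley_edges G A ^^ n"
  using assms(3)
  by (induction n arbitrary: y) (auto intro: cayley_edges_translate[OF assms(1,2)])

lemma cayley_dist_translate:
  assumes A: "A \<subseteq> carrier G" and g: "g \<in> carrier G" "x \<in> carrier G" "y \<in> carrier G"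
  shows "cayley_dist G A (g \<otimes> x) (g \<otimes> y) = cayley_dist G A x y"
proof -
  have "(g \<otimes> x, g \<otimes> y) \<in> cayley_edges G A ^^ n \<longleftrightarrow> (x, y) \<in> cayley_edges G A ^^ n" for n
    using cayley_relpow_translate[OF A inv_closed[OF g(1)], of "g \<otimes> x" "g \<otimes> y" n]
      cayley_relpow_translate[OF A g(1), of x y n] g by (auto simp: m_assoc[symmetric])
  then show ?thesis by (simp add: cayley_dist_def)
qed

lemma cayley_dist_le_iff:
  assumes "A \<subseteq> carrier G" "generate G A = carrier G" "x \<in> carrier G" "y \<in> carrier G"
  shows "cayley_dist G A x y \<le> r \<longleftrightarrow> (\<exists>n. real n \<le> r \<and> (x, y) \<in> cayley_edges G A ^^ n)"
proof
  show "cayley_dist G A x y \<le> r \<Longrightarrow> \<exists>n. real n \<le> r \<and> (x, y) \<in> cayley_edges G A ^^ n"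
    using cayley_connected[OF assms] unfolding cayley_dist_def by blast
  show "\<exists>n. real n \<le> r \<and> (x, y) \<in> cayley_edges G A ^^ n \<Longrightarrow> cayley_dist G A x y \<le> r"
    unfolding cayley_dist_def by (meson Least_le of_nat_mono order_trans)
qed

lemma finite_cayley_sphere:
  assumes "finite A" "A \<subseteq> carrier G"
  shows "finite {y. (x, y) \<in> cayley_edges G A ^^ n}"
proof (induction n)
  case (Suc n)
  have "finite {z. (y, z) \<in> cayley_edges G A}" for y
  proof (rule finite_subset)
    show "{z. (y, z) \<in> cayley_edges G A} \<subseteq> (\<lambda>a. y \<otimes> a) ` A \<union> (\<lambda>a. y \<otimes> inv a) ` A"
    proof
      fix z assume "z \<in> {z. (y, z) \<in> cayley_edges G A}"
      then obtain a where a: "y \<in> carrier G" "z \<in> carrier G" "a \<in> A" "z = y \<otimes> a \<or> y = z \<otimes> a"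
        unfolding cayley_edges_def by blast
      then have "z = y \<otimes> a \<or> z = y \<otimes> inv a"
        using assms(2) inv_solve_right[of z y a] by auto
      then show "z \<in> (\<lambda>a. y \<otimes> a) ` A \<union> (\<lambda>a. y \<otimes> inv a) ` A" using a(3) by blast
    qed
  qed (use assms in simp)
  moreover have "{z. (x, z) \<in> cayley_edges G A ^^ Suc n} =
    (\<Union>y\<in>{y. (x, y) \<in> cayley_edges G A ^^ n}. {z. (y, z) \<in> cayley_edges G A})"
    by auto
  ultimately show ?case using Suc by simp
qed simp

lemma finite_cayley_ball:
  assumes A: "finite A" "A \<subseteq> carrier G" "generate G A = carrier G" and x: "x \<in> carrier G"
  shows "finite {y \<in> carrier G. cayley_dist G A x y \<le> r}"
proof (rule finite_subset)
  show "{y \<in> carrier G. cayley_dist G A x y \<le> r} \<subseteq>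
    (\<Union>n\<in>{n. real n \<le> r}. {y. (x, y) \<in> cayley_edges G A ^^ n})"
    using cayley_dist_le_iff[OF A(2,3) x] by blast
  have "{n. real n \<le> r} \<subseteq> {..nat \<lfloor>r\<rfloor>}" by (auto simp: le_nat_floor)
  then show "finite (\<Union>n\<in>{n. real n \<le> r}. {y. (x, y) \<in> cayley_edges G A ^^ n})"
    using finite_cayley_sphere[OF A(1,2)] by (meson finite_UN_I finite_atMost finite_subset)
qed

text \<open>A path of length at most \<open>r\<close> starting in \<open>H\<close> stays in
  \<open>F\<close>, and such paths lead from \<open>\<one>\<close> to every element of
  \<open>H\<close> and from there to all of \<open>F\<close>.\<close>

lemma cayley_neighbourhood_connected:
  assumes A: "A \<subseteq> carrier G" "generate G A = carrier G"
    and H: "H \<subseteq> carrier G" "\<one> \<in> H" "\<And>h. h \<in> H \<Longrightarrow> cayley_dist G A \<one> h \<le> r"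
    and F: "F = {x \<in> carrier G. \<exists>h\<in>H. cayley_dist G A h x \<le> r}"
    and P: "P \<subseteq> F" "P \<noteq> {}" "P \<noteq> F"
  shows "\<exists>x\<in>P. \<exists>y\<in>F - P. cayley_dist G A x y \<le> 1"
proof (rule ccontr)
  assume no: "\<not> ?thesis"
  have edge_carrier: "x \<in> carrier G" "y \<in> carrier G" "cayley_dist G A x y \<le> 1"
    if "(x, y) \<in> cayley_edges G A" for x y
  proof -
    show "x \<in> carrier G" "y \<in> carrier G" using that by (auto simp: cayley_edges_def)
    then show "cayley_dist G A x y \<le> 1"
      using that cayley_dist_le_iff[OF A, of x y 1] by (auto intro!: exI[of _ 1])
  qed
  have step: "x \<in> P \<longleftrightarrow> y \<in> P" if "x \<in> F" "y \<in> F" "(x, y) \<in> cayley_edges G A" for x y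
    using no that edge_carrier(3)[OF that(3)] cayley_dist_commute by (metis DiffI)
  have path: "h \<in> P \<longleftrightarrow> x \<in> P"
    if "h \<in> H" "(h, x) \<in> cayley_edges G A ^^ n" "real n \<le> r" for h x n
    using that(2,3)
  proof (induction n arbitrary: x)
    case (Suc n)
    then obtain y where y: "(h, y) \<in> cayley_edges G A ^^ n" "(y, x) \<in> cayley_edges G A"
      by (auto elim: relpow_Suc_E)
    have "h \<in> carrier G" using that(1) H(1) by blast
    then have "y \<in> F" "x \<in> F"
      unfolding F using y Suc.prems that(1) edge_carrier(1,2)[OF y(2)]
        cayley_dist_le_iff[OF A] by (fastforce simp del: relpow.simps)+
    then show ?case using Suc.IH[OF y(1)] Suc.prems(2) step y(2) by simp
  qed simp
  have near: "h \<in> P \<longleftrightarrow> x \<in> P" if "h \<in> H" "x \<in> carrier G" "cayley_dist G A h x \<le> r" for h x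
    using path[OF that(1)] cayley_dist_le_iff[OF A _ that(2), of h r] that H(1) by blast
  have "\<one> \<in> P \<longleftrightarrow> x \<in> P" if "x \<in> F" for x
    using that near[OF H(2) _ H(3)] near H(1) unfolding F by blast
  then show False using P by blast
qed

text \<open>Left translation by \<open>inv y\<close> turns the displacement of \<open>y\<close>
  under \<open>h\<close> into the distance from \<open>\<one>\<close> to the conjugate of
  \<open>h\<close>.\<close>

lemma conjugate_subset_ball:
  assumes A: "A \<subseteq> carrier G" and H: "H \<subseteq> carrier G" and y: "y \<in> carrier G"
    and near: "\<And>h. h \<in> H \<Longrightarrow> cayley_dist G A y (h \<otimes> y) < r"
  shows "inv y <# H #> y \<subseteq> {x \<in> carrier G. cayley_dist G A \<one> x \<le> r}"
proof
  fix x assume "x \<in> inv y <# H #> y"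
  then obtain h where h: "h \<in> H" "x = inv y \<otimes> h \<otimes> y"
    unfolding l_coset_def r_coset_def by blast
  then have hG: "h \<in> carrier G" using H by blast
  have "cayley_dist G A (inv y \<otimes> y) (inv y \<otimes> (h \<otimes> y)) < r"
    using cayley_dist_translate[OF A, of "inv y" y "h \<otimes> y"] near[OF h(1)] y hG by simp
  then show "x \<in> {x \<in> carrier G. cayley_dist G A \<one> x \<le> r}"
    using h(2) y hG by (simp add: m_assoc)
qed

lemma conj_class_conjugate:
  assumes H: "H \<subseteq> carrier G" and y: "y \<in> carrier G"
  shows "subgroup_conj_class G (inv y <# H #> y) = subgroup_conj_class G H"
proof -
  have conj: "g <# (inv y <# H #> y) #> inv g = (g \<otimes> inv y) <# H #> inv (g \<otimes> inv y)"
    if "g \<in> carrier G" for g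
    using that H y
    by (simp add: coset_assoc lcos_m_assoc coset_mult_assoc l_coset_subset_G inv_mult_group)
  show ?thesis
    unfolding subgroup_conj_class_def
  proof safe
    fix g assume g: "g \<in> carrier G"
    then show "\<exists>ga. g <# (inv y <# H #> y) #> inv g = ga <# H #> inv ga \<and> ga \<in> carrier G"
      using conj[OF g] y by blast
    have "g <# H #> inv g = (g \<otimes> y) <# (inv y <# H #> y) #> inv (g \<otimes> y)"
      using conj[of "g \<otimes> y"] g y by (simp add: m_assoc)
    then show "\<exists>ga. g <# H #> inv g = ga <# (inv y <# H #> y) #> inv ga \<and> ga \<in> carrier G"
      using g y by blast
  qed
qed

end

section \<open>Almost fixed points and the count of conjugacy classes\<close>

context HHG
begin

lemma almost_fixed_point:
  assumes H: "subgroup H G" "finite H"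
  shows "\<exists>y\<in>carrier G. \<forall>h\<in>H. \<forall>W\<in>\<SS>. mdist (\<C> W) (\<pi> W y) (\<pi> W (h \<otimes> y)) \<le> 500 * E"
proof (cases "\<SS> = {}")
  case False
  note A = generators_subset generates
  note X = mspace_cayley_metric[OF A] mdist_cayley_metric[OF A]
  interpret H: subgroup H G by (rule H(1))
  \<comment> \<open>The radius for which the neighbourhood \<open>F\<close> of \<open>H\<close> is
    connected.\<close>
  define r where "r = Max (cayley_dist G A \<one> ` H)"
  have r: "cayley_dist G A \<one> h \<le> r" if "h \<in> H" for h
    unfolding r_def using H(2) that by simp
  define F where "F = {x \<in> carrier G. \<exists>h\<in>H. cayley_dist G A h x \<le> r}"
  have "F = (\<Union>h\<in>H. {x \<in> carrier G. cayley_dist G A h x \<le> r})" unfolding F_def by blast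
  then have fin: "finite F"
    using finite_cayley_ball[OF finite_generators A] H(2) H.mem_carrier by simp
  have FX: "F \<subseteq> carrier G" unfolding F_def by blast
  have "\<one> \<in> F" using r H.one_closed unfolding F_def by blast
  then have ne: "F \<noteq> {}" by blast
  have conn: "\<exists>x\<in>P. \<exists>y\<in>F - P. mdist (cayley_metric G A) x y \<le> 1"
    if "P \<subseteq> F" "P \<noteq> {}" "P \<noteq> F" for P
    using cayley_neighbourhood_connected[OF A H.subset H.one_closed r F_def that] X by simp
  have H_F: "h \<otimes> x \<in> F" if h: "h \<in> H" and x: "x \<in> F" for h x
  proof -
    obtain k where k: "k \<in> H" "cayley_dist G A k x \<le> r" using x unfolding F_def by blast
    then have "cayley_dist G A (h \<otimes> k) (h \<otimes> x) \<le> r"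
      using cayley_dist_translate[OF A(1)] h x FX H.mem_carrier by (metis subsetD)
    moreover have "h \<otimes> k \<in> H" "h \<otimes> x \<in> carrier G" using h k(1) x FX by auto
    ultimately show ?thesis unfolding F_def by (intro CollectI conjI bexI)
  qed
  have bij: "bij_betw (\<lambda>x. h \<otimes> x) F F" if h: "h \<in> H" for h
  proof (rule bij_betw_byWitness[where f' = "\<lambda>x. inv h \<otimes> x"])
    have "h \<in> carrier G" using h by simp
    then show "\<forall>x\<in>F. inv h \<otimes> (h \<otimes> x) = x" "\<forall>x\<in>F. h \<otimes> (inv h \<otimes> x) = x"
      using FX by (auto simp: m_assoc[symmetric])
  qed (use H_F h H.m_inv_closed in auto)
  obtain y where y: "y \<in> carrier G"
    and near: "\<And>W c. W \<in> \<SS> \<Longrightarrow> median_center (\<C> W) (\<pi> W) F (22 * E) c \<Longrightarrow>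
      mdist (\<C> W) (\<pi> W y) c \<le> 250 * E"
    using median_point[OF fin ne _ conn False] FX X(1) by metis
  have "mdist (\<C> W) (\<pi> W y) (\<pi> W (h \<otimes> y)) \<le> 500 * E" if h: "h \<in> H" and W: "W \<in> \<SS>" for h W
  proof -
    have hG: "h \<in> carrier G" using h by simp
    define V where "V = act (inv h) W"
    have V: "V \<in> \<SS>" unfolding V_def using element_image[of "inv h" W] hG W by simp
    have W_eq: "act h V = W"
      using orbit_sym_aux[OF inv_closed[OF hG] W V_def[symmetric]] hG by simp
    have \<phi>: "isometry_onto (\<C> V) (\<C> W) (iso h V)" using isometry[OF hG V] unfolding W_eq .
    have \<phi>\<pi>: "\<pi> W (h \<otimes> x) = iso h V (\<pi> V x)" if "x \<in> carrier G" for x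
      using iso_proj[OF hG V that] unfolding W_eq by simp
    have piF: "\<pi> V ` F \<subseteq> mspace (\<C> V)" using pi_in[OF V] FX X(1) by auto
    obtain c where c: "median_center (\<C> V) (\<pi> V) F (22 * E) c"
      using median_center_exists[OF geodesic[OF V] hyperbolic[OF V] E_ge_1 fin ne piF] by blast
    have c': "median_center (\<C> W) (\<pi> W) F (22 * E) (iso h V c)"
      by (rule median_center_isometry[OF \<phi> c piF bij[OF h]]) (use \<phi>\<pi> FX in auto)
    \<comment> \<open>Applying \<open>h\<close> to \<open>y\<close> and to a median \<open>c\<close>
      in \<open>V\<close> puts \<open>h \<otimes> y\<close> near a median in \<open>W\<close>;
      \<open>y\<close> is near that median as well, so the two bounds of \<open>250 * E\<close> add
      up.\<close>
    have "mdist (\<C> W) (\<pi> W (h \<otimes> y)) (iso h V c) = mdist (\<C> V) (\<pi> V y) c"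
      using \<phi> c pi_in[OF V] y X(1) unfolding \<phi>\<pi>[OF y] isometry_onto_def median_center_def by auto
    then show ?thesis
      using near[OF V c] near[OF W c'] mdist_triangle[of "\<pi> W y" "\<C> W" "iso h V c" "\<pi> W (h \<otimes> y)"]
        pi_in[OF W] y hG X(1) c' by (simp add: mdist_commute median_center_def)
  qed
  then show ?thesis using y by blast
qed auto

lemma finite_conj_classes: "finite (subgroup_conj_class G ` {H. subgroup H G \<and> finite H})"
proof -
  note A = generators_subset generates
  note X = mspace_cayley_metric[OF A] mdist_cayley_metric[OF A]
  \<comment> \<open>Strictly above the bound for almost fixed points, so uniqueness makes their
    displacement less than \<open>\<theta>\<close>.\<close>
  have "500 * E + 1 \<ge> 0" using E_ge_1 by simp
  from uniqueness[OF this] obtain \<theta> where \<theta>: "\<And>x y. x \<in> carrier G \<Longrightarrow> y \<in> carrier G \<Longrightarrow>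
      \<theta> \<le> cayley_dist G A x y \<Longrightarrow> \<exists>V\<in>\<SS>. 500 * E + 1 \<le> mdist (\<C> V) (\<pi> V x) (\<pi> V y)"
    unfolding X by blast
  let ?B = "{x \<in> carrier G. cayley_dist G A \<one> x \<le> \<theta>}"
  \<comment> \<open>Classes of arbitrary subsets of the ball are counted; there are finitely many
    such subsets.\<close>
  have "subgroup_conj_class G H \<in> subgroup_conj_class G ` Pow ?B"
    if H: "subgroup H G" "finite H" for H
  proof -
    have HG: "H \<subseteq> carrier G" using subgroup.subset[OF H(1)] .
    obtain y where y: "y \<in> carrier G"
      "\<And>h W. h \<in> H \<Longrightarrow> W \<in> \<SS> \<Longrightarrow> mdist (\<C> W) (\<pi> W y) (\<pi> W (h \<otimes> y)) \<le> 500 * E"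
      using almost_fixed_point[OF H] by blast
    have "cayley_dist G A y (h \<otimes> y) < \<theta>" if h: "h \<in> H" for h
    proof (rule ccontr)
      assume "\<not> ?thesis"
      then obtain V where "V \<in> \<SS>" "500 * E + 1 \<le> mdist (\<C> V) (\<pi> V y) (\<pi> V (h \<otimes> y))"
        using \<theta>[of y "h \<otimes> y"] y(1) h HG by auto
      then show False using y(2)[OF h] by fastforce
    qed
    then have "inv y <# H #> y \<subseteq> ?B" using conjugate_subset_ball[OF A(1) HG y(1)] by blast
    then show ?thesis using conj_class_conjugate[OF HG y(1)] by blast
  qed
  then have "subgroup_conj_class G ` {H. subgroup H G \<and> finite H} \<subseteq> subgroup_conj_class G ` Pow ?B"
    by blast
  then show ?thesis
    using finite_cayley_ball[OF finite_generators A one_closed, of \<theta>]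
    by (meson finite_Pow_iff finite_imageI finite_subset)
qed

end

theorem theoremG:
  fixes G :: "('g, 'm) monoid_scheme"
    and A :: "'g set"
    and \<SS> :: "'u set"
    and nest orth :: "'u \<Rightarrow> 'u \<Rightarrow> bool"
    and \<C> :: "'u \<Rightarrow> 'c metric"
    and \<pi> :: "'u \<Rightarrow> 'g \<Rightarrow> 'c"
    and \<rho> :: "'u \<Rightarrow> 'u \<Rightarrow> 'c set"
    and \<rho>map :: "'u \<Rightarrow> 'u \<Rightarrow> 'c \<Rightarrow> 'c"
    and E :: real
    and act :: "'g \<Rightarrow> 'u \<Rightarrow> 'u"
    and iso :: "'g \<Rightarrow> 'u \<Rightarrow> 'c \<Rightarrow> 'c"
  assumes "HHG G A \<SS> nest orth \<C> \<pi> \<rho> \<rho>map E act iso"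
  shows "finite (subgroup_conj_class G ` {H. subgroup H G \<and> finite H})"
  using HHG.finite_conj_classes[OF assms] .

end
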